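(* Let $q$ be a prime power and $r\ge 1$ an integer. If the elliptic quadric $\mathcal Q^-(2r+1,q)$ possesses an $m$-ovoid, then \[F(m)\equiv 0 \pmod{q+1},\] where $F(m)=m^2-m$ if $r$ is odd; $F(m)=m^2$ if $r$ is even and $q$ is even; and $F(m)=m^2+\frac{q+1}{2}m$ if $r$ is even and $q$ is odd.
   Context: $\mathcal Q^-(2r+1,q)$ denotes the elliptic polar space of rank $r$: the set of projective points of $\mathrm{PG}(2r+1,q)$ (underlying vector space $\mathbb F_q^{2r+2}$) that are singular for a non-degenerate quadratic form of Witt index $r$ (e.g. $x_0x_1+\dots+x_{2r-2}x_{2r-1}+g(x_{2r},x_{2r+1})$ with $g$ an irreducible binary quadratic form). Its generators are its maximal totally singular subspaces, which are projective $(r-1)$-spaces. An $m$-ovoid is a set $\mathcal O$ of points of the quadric such that every generator contains exactly $m$ points of $\mathcal O$. *)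

theory Defs
  imports "HOL-Analysis.Cartesian_Space" "HOL-Number_Theory.Cong"
begin

definition polar_form :: "('a::field ^ 'n \<Rightarrow> 'a) \<Rightarrow> 'a ^ 'n \<Rightarrow> 'a ^ 'n \<Rightarrow> 'a" where
  "polar_form Q x y = Q (x + y) - Q x - Q y"

text \<open>This is the characteristic-free notion of a quadratic form; in characteristic 2
  the form is not determined by its polar form.\<close>

definition quadratic_form :: "('a::field ^ 'n \<Rightarrow> 'a) \<Rightarrow> bool" where
  "quadratic_form Q \<longleftrightarrow>
     (\<forall>c x. Q (c *s x) = c\<^sup>2 * Q x) \<and>
     (\<forall>y. Vector_Spaces.linear (*s) (*) (\<lambda>x. polar_form Q x y)) \<and>
     (\<forall>x. Vector_Spaces.linear (*s) (*) (\<lambda>y. polar_form Q x y))"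

text \<open>Non-degeneracy of the quadratic form: no nonzero singular vector lies in the radical
  of the polar form.\<close>

definition nondegenerate :: "('a::field ^ 'n \<Rightarrow> 'a) \<Rightarrow> bool" where
  "nondegenerate Q \<longleftrightarrow> (\<forall>x. Q x = 0 \<and> (\<forall>y. polar_form Q x y = 0) \<longrightarrow> x = 0)"

definition totally_singular :: "('a::field ^ 'n \<Rightarrow> 'a) \<Rightarrow> ('a ^ 'n) set \<Rightarrow> bool" where
  "totally_singular Q U \<longleftrightarrow> vec.subspace U \<and> (\<forall>x\<in>U. Q x = 0)"

definition witt_index :: "('a::field ^ 'n \<Rightarrow> 'a) \<Rightarrow> nat" where
  "witt_index Q = Max {vec.dim U | U. totally_singular Q U}"

text \<open>\<open>Q\<close> is a form defining the elliptic quadric \<open>Q\<^sup>-(2r+1,q)\<close>, where \<open>q\<close> is the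
  order of the field \<open>'a\<close>.\<close>

definition elliptic_form :: "nat \<Rightarrow> ('a::field ^ 'n \<Rightarrow> 'a) \<Rightarrow> bool" where
  "elliptic_form r Q \<longleftrightarrow>
     CARD('n) = 2 * r + 2 \<and> quadratic_form Q \<and> nondegenerate Q \<and> witt_index Q = r"

text \<open>Projective points are the one-dimensional subspaces.\<close>

definition quadric_points :: "('a::field ^ 'n \<Rightarrow> 'a) \<Rightarrow> ('a ^ 'n) set set" where
  "quadric_points Q = {P. vec.subspace P \<and> vec.dim P = 1 \<and> (\<forall>x\<in>P. Q x = 0)}"

definition generator :: "('a::field ^ 'n \<Rightarrow> 'a) \<Rightarrow> ('a ^ 'n) set \<Rightarrow> bool" where
  "generator Q U \<longleftrightarrow>
     totally_singular Q U \<and> (\<forall>W. totally_singular Q W \<and> U \<subseteq> W \<longrightarrow> W = U)"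

definition m_ovoid :: "('a::field ^ 'n \<Rightarrow> 'a) \<Rightarrow> nat \<Rightarrow> ('a ^ 'n) set set \<Rightarrow> bool" where
  "m_ovoid Q m \<O> \<longleftrightarrow>
     \<O> \<subseteq> quadric_points Q \<and> (\<forall>U. generator Q U \<longrightarrow> card {P \<in> \<O>. P \<subseteq> U} = m)"

definition ovoid_F :: "nat \<Rightarrow> nat \<Rightarrow> nat \<Rightarrow> int" where
  "ovoid_F r q m =
     (if odd r then (int m)\<^sup>2 - int m
      else if even q then (int m)\<^sup>2
      else (int m)\<^sup>2 + (int q + 1) div 2 * int m)"

end

theory Submission
  imports Defs
begin

text \<open>Work with integer weights \<open>f\<close> on the singular points whose sum over every generator is
  \<open>m\<close>. Fix a singular point \<open>p\<close>. Summing \<open>f\<close> along the lines through \<open>p\<close> (without \<open>p\<close>) gives a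
  weight \<open>s\<close> of the same kind, with sums \<open>m - f p\<close>, on the elliptic quadric \<open>p\<^sup>\<bottom>/p\<close> of rank
  \<open>r - 1\<close>. All hyperplane sums of \<open>f\<close> are determined by \<open>m\<close> and \<open>f\<close>, which expresses the values of
  \<open>f\<close> off \<open>p\<^sup>\<bottom>\<close> through those on \<open>p\<^sup>\<bottom>\<close>, and yields the identity
  \<open>\<Sum>f\<^sup>2 = (f p)\<^sup>2 + ((q - 1) m + f p)\<^sup>2 + (q + 1) A - \<Sum>s\<^sup>2\<close>, where \<open>A\<close> is the sum of \<open>f\<^sup>2\<close> over the
  points of \<open>p\<^sup>\<bottom>\<close> other than \<open>p\<close>. By induction on \<open>r\<close>, \<open>\<Sum>f\<^sup>2 \<equiv> 2 m\<^sup>2\<close> modulo \<open>q + 1\<close>, and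
  even modulo \<open>2 (q + 1)\<close> for odd \<open>q\<close>. For an \<open>m\<close>-ovoid \<open>f\<^sup>2 = f\<close>, so the left-hand side is
  \<open>m (q ^ (r + 1) + 1)\<close>.\<close>

section \<open>Sums over finite vector spaces\<close>

text \<open>The fibres of \<phi> on \<open>W\<close> are cosets of its kernel, so all have the same
  size \<open>k\<close>. The equation is multiplied out to avoid division, and \<open>W\<close> may
  be any subgroup, so that it applies to subspaces.\<close>

lemma sum_surj_additive:
  fixes \<phi> :: "'v::{ab_group_add,finite} \<Rightarrow> 'b::{ab_group_add,finite}" and g :: "'b \<Rightarrow> int"
  assumes add: "\<And>x y. x \<in> W \<Longrightarrow> y \<in> W \<Longrightarrow> \<phi> (x + y) = \<phi> x + \<phi> y"
    and closed: "\<And>x y. x \<in> W \<Longrightarrow> y \<in> W \<Longrightarrow> x + y \<in> W" "\<And>x. x \<in> W \<Longrightarrow> - x \<in> W"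
    and surj: "\<And>b. \<exists>x\<in>W. \<phi> x = b"
  shows "int CARD('b) * (\<Sum>x\<in>W. g (\<phi> x)) = int (card W) * (\<Sum>b\<in>UNIV. g b)"
proof -
  let ?F = "\<lambda>b. {x \<in> W. \<phi> x = b}"
  define k where "k = card (?F 0)"
  have fib: "card (?F b) = k" for b
  proof -
    obtain y where y: "y \<in> W" "\<phi> y = b" using surj by blast
    have "bij_betw (\<lambda>x. x + y) (?F 0) (?F b)"
    proof (rule bij_betw_byWitness[where f' = "\<lambda>x. x + - y"])
      show "(\<lambda>x. x + y) ` ?F 0 \<subseteq> ?F b" using y by (auto simp: add closed)
      show "(\<lambda>x. x + - y) ` ?F b \<subseteq> ?F 0"
      proof clarify
        fix x assume x: "x \<in> W" "b = \<phi> x"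
        then have w: "x + - y \<in> W" by (simp add: closed y del: add_uminus_conv_diff)
        have "\<phi> ((x + - y) + y) = \<phi> (x + - y) + \<phi> y" using w y(1) by (rule add)
        then have "\<phi> (x + - y) = 0" using x y by simp
        then show "x + - y \<in> W \<and> \<phi> (x + - y) = 0" using w by blast
      qed
    qed auto
    then show ?thesis by (simp add: bij_betw_same_card k_def)
  qed
  have part: "(\<Sum>x\<in>W. h x) = (\<Sum>b\<in>UNIV. \<Sum>x\<in>?F b. h x)" for h :: "'v \<Rightarrow> int"
    using sum.group[of W UNIV \<phi> h] by simp
  have "(\<Sum>x\<in>W. g (\<phi> x)) = (\<Sum>b\<in>UNIV. \<Sum>x\<in>?F b. g b)" 
    by (subst part) (auto intro!: sum.cong)
  also have "\<dots> = int k * (\<Sum>b\<in>UNIV. g b)"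
    by (simp add: fib sum_distrib_left)
  finally have 1: "(\<Sum>x\<in>W. g (\<phi> x)) = int k * (\<Sum>b\<in>UNIV. g b)" .
  have "int (card W) = (\<Sum>b\<in>UNIV. int (card (?F b)))"
    using part[of "\<lambda>_. 1"] by simp
  also have "\<dots> = int CARD('b) * int k" by (simp add: fib)
  finally show ?thesis using 1 by simp
qed

lemma span_scale_eq:
  fixes x :: "'a::field ^ 'n"
  assumes "c \<noteq> 0"
  shows "vec.span {c *s x} = vec.span {x}"
proof (rule vec.span_eq[THEN iffD2], safe)
  show "c *s x \<in> vec.span {x}" by (simp add: vec.span_base vec.span_scale)
  have "x = inverse c *s (c *s x)" using assms by simp
  then show "x \<in> vec.span {c *s x}" by (metis insertI1 vec.span_base vec.span_scale)
qed

text \<open>Every point spanned by a vector of \<open>S\<close> contributes its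
  \<open>CARD('a) - 1\<close> nonzero vectors. \<open>SOME\<close> picks a representative, whose
  choice is immaterial by the invariance of \<open>h\<close>.\<close>

lemma sum_scalar_invariant:
  fixes h :: "'a::{field,finite}^'n \<Rightarrow> int"
  assumes hom: "\<And>c x. c \<noteq> 0 \<Longrightarrow> h (c *s x) = h x" and sc: "\<And>c x. c \<noteq> 0 \<Longrightarrow> x \<in> S \<Longrightarrow> c *s x \<in> S"
    and "0 \<notin> S" and "finite S"
  shows "(\<Sum>x\<in>S. h x) = (int CARD('a) - 1) * (\<Sum>P\<in>(\<lambda>x. vec.span {x}) ` S. h (SOME x. x \<in> S \<and> vec.span {x} = P))"
proof -
  let ?I = "(\<lambda>x. vec.span {x}) ` S"
  have "(\<Sum>x\<in>S. h x) = (\<Sum>P\<in>?I. \<Sum>x\<in>{x\<in>S. vec.span {x} = P}. h x)"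
    using sum.group[of S ?I "\<lambda>x. vec.span {x}" h] assms by simp
  also have "\<dots> = (\<Sum>P\<in>?I. (int CARD('a) - 1) * h (SOME x. x \<in> S \<and> vec.span {x} = P))"
  proof (rule sum.cong[OF refl])
    fix P assume P: "P \<in> ?I"
    define y where "y = (SOME x. x \<in> S \<and> vec.span {x} = P)"
    have y: "y \<in> S" "vec.span {y} = P"
      using someI_ex[of "\<lambda>x. x \<in> S \<and> vec.span {x} = P"] P unfolding y_def by auto
    have y0: "y \<noteq> 0" using y assms by auto
    have eq: "{x\<in>S. vec.span {x} = P} = (\<lambda>c. c *s y) ` (UNIV - {0})"
    proof
      show "{x\<in>S. vec.span {x} = P} \<subseteq> (\<lambda>c. c *s y) ` (UNIV - {0})"
      proof
        fix x assume x: "x \<in> {x\<in>S. vec.span {x} = P}"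
        then have "x \<in> vec.span {y}" using y vec.span_base[of x "{x}"] by auto
        then obtain c where c: "x = c *s y" by (auto simp: vec.span_singleton)
        have "c \<noteq> 0" using c x assms by auto
        then show "x \<in> (\<lambda>c. c *s y) ` (UNIV - {0})" using c by auto
      qed
      show "(\<lambda>c. c *s y) ` (UNIV - {0}) \<subseteq> {x\<in>S. vec.span {x} = P}"
      proof clarify
        fix c :: 'a assume c: "c \<noteq> 0"
        have "vec.span {c *s y} = vec.span {y}" using c by (rule span_scale_eq)
        then show "c *s y \<in> S \<and> vec.span {c *s y} = P" using sc c y by auto
      qed
    qed
    have inj: "inj_on (\<lambda>c. c *s y) (UNIV - {0})"
      using y0 by (auto simp: inj_on_def)
    have "(\<Sum>x\<in>{x\<in>S. vec.span {x} = P}. h x) = (\<Sum>c\<in>UNIV - {0::'a}. h (c *s y))"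
      unfolding eq using inj by (simp add: sum.reindex)
    also have "\<dots> = (\<Sum>c\<in>UNIV - {0::'a}. h y)"
      by (rule sum.cong) (auto simp: hom)
    also have "\<dots> = (int CARD('a) - 1) * h y"
      by (simp add: card_Diff_singleton of_nat_diff)
    finally show "(\<Sum>x\<in>{x\<in>S. vec.span {x} = P}. h x) = (int CARD('a) - 1) * h (SOME x. x \<in> S \<and> vec.span {x} = P)" 
      unfolding y_def .
  qed
  finally show ?thesis by (simp add: sum_distrib_left)
qed

section \<open>Quadratic spaces and hyperbolic pairs\<close>

text \<open>The order of the field is carried as an integer because the counting identities contain
  subtractions.\<close>

locale quadratic_space =
  fixes Q :: "'a::{field,finite} ^ 'n::finite \<Rightarrow> 'a"
    and q :: int
  assumes quadratic: "quadratic_form Q"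
    and q_def: "q = int CARD('a)"
begin

abbreviation B where "B \<equiv> polar_form Q"

lemma Q_scale [simp]: "Q (c *s x) = c\<^sup>2 * Q x"
  using quadratic by (simp add: quadratic_form_def)

lemma B_commute: "B x y = B y x"
  by (simp add: polar_form_def add.commute)

lemma B_add_left [simp]: "B (x + x') y = B x y + B x' y"
proof -
  have "Vector_Spaces.linear (*s) (*) (\<lambda>x. B x y)"
    using quadratic unfolding quadratic_form_def by blast
  then show ?thesis
    by (simp add: Vector_Spaces.linear_def module_hom_def module_hom_axioms_def)
qed

lemma B_add_right [simp]: "B y (x + x') = B y x + B y x'"
  using B_add_left[of x x' y] by (simp only: B_commute[of y])

lemma B_scale_left [simp]: "B (c *s x) y = c * B x y"
proof -
  have "Vector_Spaces.linear (*s) (*) (\<lambda>x. B x y)"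
    using quadratic unfolding quadratic_form_def by blast
  then show ?thesis
    by (simp add: Vector_Spaces.linear_def module_hom_def module_hom_axioms_def)
qed

lemma B_scale_right [simp]: "B y (c *s x) = c * B y x"
  using B_scale_left[of c x y] by (simp only: B_commute[of y])

lemma Q_add: "Q (x + y) = Q x + Q y + B x y"
  by (simp add: polar_form_def)

lemma Q_zero [simp]: "Q 0 = 0"
  using Q_scale[of 0 0] by simp

lemma B_zero [simp]: "B 0 y = 0" "B y 0 = 0"
  using B_scale_left[of 0 0 y] B_scale_right[of y 0 0] by simp_all

lemma B_minus [simp]: "B (- x) y = - B x y" "B y (- x) = - B y x"
  using B_scale_left[of "-1" x y] B_scale_right[of y "-1" x] by simp_all

lemma B_diff [simp]: "B (x - x') y = B x y - B x' y" "B y (x - x') = B y x - B y x'"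
  using B_add_left[of x "-x'" y] B_add_right[of y x "-x'"] by simp_all

lemma B_self: "B x x = 2 * Q x"
proof -
  have "x + x = 2 *s x" by (simp add: vec_eq_iff)
  then have "Q (x + x) = 4 * Q x" by simp
  then show ?thesis by (simp add: polar_form_def)
qed

definition perp_pair :: "('a ^ 'n) set \<Rightarrow> 'a ^ 'n \<Rightarrow> 'a ^ 'n \<Rightarrow> ('a ^ 'n) set" where
  "perp_pair W p p' = {x \<in> W. B p x = 0 \<and> B p' x = 0}"

definition hyperbolic_pair :: "('a ^ 'n) set \<Rightarrow> 'a ^ 'n \<Rightarrow> 'a ^ 'n \<Rightarrow> bool" where
  "hyperbolic_pair W p p' \<longleftrightarrow>
     vec.subspace W \<and> p \<in> W \<and> p' \<in> W \<and> Q p = 0 \<and> Q p' = 0 \<and> B p p' = 1"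

lemma q_ge_2: "q \<ge> 2"
proof -
  have "card {0, 1 :: 'a} \<le> CARD('a)" by (rule card_mono) auto
  then show ?thesis by (simp add: q_def)
qed

lemma finite_vec [simp]: "finite (A :: ('a ^ 'n) set)"
  by (rule finite_subset[OF subset_UNIV]) simp

lemma hyperbolic_pair_B:
  assumes "hyperbolic_pair W p p'"
  shows "B p p = 0" "B p' p' = 0" "B p' p = 1"
  using assms B_commute[of p' p] by (auto simp: hyperbolic_pair_def B_self)

lemma subspace_perp_pair:
  "vec.subspace W \<Longrightarrow> vec.subspace (perp_pair W p p')"
  by (auto simp: vec.subspace_def perp_pair_def)

text \<open>Every \<open>x\<close> in \<open>W\<close> is uniquely
  \<open>a *s p + b *s p' + w\<close>; pairing with the opposite vector of the hyperbolic pair reads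
  off \<open>a = B p' x\<close> and \<open>b = B p x\<close>.\<close>

lemma sum_hyperbolic_split:
  assumes "hyperbolic_pair W p p'"
  shows "(\<Sum>x\<in>W. g x) = (\<Sum>a\<in>UNIV. \<Sum>b\<in>UNIV. \<Sum>w\<in>perp_pair W p p'. (g (a *s p + b *s p' + w) :: int))"
proof -
  note hp = assms[unfolded hyperbolic_pair_def] hyperbolic_pair_B[OF assms]
  let ?W' = "perp_pair W p p'"
  have "bij_betw (\<lambda>(a, b, w). a *s p + b *s p' + w) (UNIV \<times> UNIV \<times> ?W') W"
  proof (rule bij_betw_byWitness[where f' = "\<lambda>x. (B p' x, B p x, x - B p' x *s p - B p x *s p')"])
    show "(\<lambda>(a, b, w). a *s p + b *s p' + w) ` (UNIV \<times> UNIV \<times> ?W') \<subseteq> W"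
      using hp by (auto simp: perp_pair_def vec.subspace_add vec.subspace_scale)
    show "(\<lambda>x. (B p' x, B p x, x - B p' x *s p - B p x *s p')) ` W \<subseteq> UNIV \<times> UNIV \<times> ?W'"
      using hp by (auto simp: perp_pair_def vec.subspace_diff vec.subspace_scale)
  qed (use hp in \<open>auto simp: perp_pair_def\<close>)
  from sum.reindex_bij_betw[OF this, of g]
  show ?thesis by (simp add: sum.cartesian_product case_prod_unfold)
qed

lemma card_perp_pair:
  assumes "hyperbolic_pair W p p'"
  shows "int (card W) = q\<^sup>2 * int (card (perp_pair W p p'))"
  using sum_hyperbolic_split[OF assms, of "\<lambda>_. 1"] by (simp add: power2_eq_square q_def)

lemma Q_split:
  assumes "hyperbolic_pair W p p'" "w \<in> perp_pair W p p'"
  shows "Q (a *s p + b *s p' + w) = a * b + Q w"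
  using assms hyperbolic_pair_B[OF assms(1)] B_commute[of w]
  by (auto simp: Q_add hyperbolic_pair_def perp_pair_def)

section \<open>Elliptic subspaces\<close>

definition no_singular_radical :: "('a ^ 'n) set \<Rightarrow> bool" where
  "no_singular_radical W \<longleftrightarrow> (\<forall>x\<in>W. Q x = 0 \<and> (\<forall>y\<in>W. B x y = 0) \<longrightarrow> x = 0)"

text \<open>The rank belongs to a subspace of a fixed ambient space, so that an induction can lower
  it without changing the type. Dimensions are encoded by cardinalities: the last two clauses say
  that the Witt index on \<open>W\<close> is \<open>r\<close>.\<close>

definition elliptic_on :: "nat \<Rightarrow> ('a ^ 'n) set \<Rightarrow> bool" where
  "elliptic_on r W \<longleftrightarrow> vec.subspace W \<and> no_singular_radical W \<and> card W = CARD('a) ^ (2 * r + 2) \<and>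
     (\<exists>U. totally_singular Q U \<and> U \<subseteq> W \<and> card U = CARD('a) ^ r) \<and>
     (\<forall>U. totally_singular Q U \<and> U \<subseteq> W \<longrightarrow> card U \<le> CARD('a) ^ r)"

definition generator_on :: "('a ^ 'n) set \<Rightarrow> ('a ^ 'n) set \<Rightarrow> bool" where
  "generator_on W U \<longleftrightarrow> totally_singular Q U \<and> U \<subseteq> W \<and>
     (\<forall>X. totally_singular Q X \<and> X \<subseteq> W \<and> U \<subseteq> X \<longrightarrow> X = U)"

section \<open>Totally singular subspaces and their extensions by a vector\<close>

lemma totally_singular_B:
  assumes "totally_singular Q U" "x \<in> U" "y \<in> U"
  shows "B x y = 0"
  using assms vec.subspace_add[of U x y] by (auto simp: totally_singular_def polar_form_def)

definition extend_by :: "'a ^ 'n \<Rightarrow> ('a ^ 'n) set \<Rightarrow> ('a ^ 'n) set" where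
  "extend_by p U = (\<lambda>(a, u). a *s p + u) ` (UNIV \<times> U)"

lemma mem_extend_by: "u \<in> U \<Longrightarrow> a *s p + u \<in> extend_by p U"
  unfolding extend_by_def by (rule image_eqI[of _ _ "(a, u)"]) simp_all

lemma subspace_extend_by:
  assumes "vec.subspace U"
  shows "vec.subspace (extend_by p U)"
proof (rule vec.subspaceI)
  show "0 \<in> extend_by p U"
    using mem_extend_by[OF vec.subspace_0[OF assms], of 0 p] by simp
next
  fix x y assume "x \<in> extend_by p U" "y \<in> extend_by p U"
  then obtain a u b v where "x = a *s p + u" "y = b *s p + v" "u \<in> U" "v \<in> U"
    unfolding extend_by_def by auto
  then have "x + y = (a + b) *s p + (u + v)" "u + v \<in> U"
    using vec.subspace_add[OF assms] by (auto simp: vec.scale_left_distrib)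
  then show "x + y \<in> extend_by p U" by (simp only: mem_extend_by)
next
  fix c x assume "x \<in> extend_by p U"
  then obtain a u where "x = a *s p + u" "u \<in> U"
    unfolding extend_by_def by auto
  then have "c *s x = (c * a) *s p + c *s u" "c *s u \<in> U"
    using vec.subspace_scale[OF assms] by (auto simp: vec.scale_right_distrib)
  then show "c *s x \<in> extend_by p U" by (simp only: mem_extend_by)
qed

lemma totally_singular_extend_by:
  assumes "totally_singular Q U" "Q p = 0" "\<And>u. u \<in> U \<Longrightarrow> B p u = 0"
  shows "totally_singular Q (extend_by p U)"
  using assms subspace_extend_by[of U p]
  by (auto simp: totally_singular_def extend_by_def Q_add)

lemma inj_extend_by:
  assumes "vec.subspace U" "p \<notin> U"
  shows "inj_on (\<lambda>(a, u). a *s p + u) (UNIV \<times> U)"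
proof (rule inj_onI, clarify)
  fix a u b v assume u: "u \<in> U" "v \<in> U" and eq: "a *s p + u = b *s p + v"
  have e: "(a - b) *s p = v - u" using eq by (simp add: vec.scale_left_diff_distrib algebra_simps)
  have "a = b"
  proof (rule ccontr)
    assume "a \<noteq> b"
    have "p = inverse (a - b) *s ((a - b) *s p)" using \<open>a \<noteq> b\<close> by simp
    also have "\<dots> \<in> U" unfolding e using u assms by (simp add: vec.subspace_diff vec.subspace_scale)
    finally show False using assms by simp
  qed
  then show "a = b \<and> u = v" using eq by simp
qed

lemma sum_extend_by:
  assumes "vec.subspace U" "p \<notin> U"
  shows "(\<Sum>x\<in>extend_by p U. (g x :: int)) = (\<Sum>a\<in>UNIV. \<Sum>u\<in>U. g (a *s p + u))"
  unfolding extend_by_def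
  by (subst sum.reindex[OF inj_extend_by[OF assms]]) (simp add: sum.cartesian_product case_prod_unfold)

lemma card_extend_by:
  assumes "vec.subspace U" "p \<notin> U"
  shows "card (extend_by p U) = CARD('a) * card U"
  unfolding extend_by_def
  by (subst card_image[OF inj_extend_by[OF assms]]) (simp add: card_cartesian_product)

text \<open>Rank-nullity for the functional \<open>B z\<close>, in cardinalities: its fibres on
  \<open>U\<close> are equally large, and the indicator of 0 singles out the kernel.\<close>

lemma card_functional_kernel:
  assumes "vec.subspace U" "y \<in> U" "B z y \<noteq> 0"
  shows "card U = CARD('a) * card {x \<in> U. B z x = 0}"
proof -
  have "int CARD('a) * (\<Sum>x\<in>U. (if B z x = 0 then 1 else 0)) = int (card U) * (\<Sum>b\<in>(UNIV::'a set). if b = 0 then 1 else 0)"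
  proof (rule sum_surj_additive)
    fix b show "\<exists>x\<in>U. B z x = b"
      using assms by (intro bexI[of _ "(b / B z y) *s y"]) (auto simp: vec.subspace_scale)
  qed (use assms in \<open>auto simp: vec.subspace_add vec.subspace_neg\<close>)
  then have "int CARD('a) * int (card {x \<in> U. B z x = 0}) = int (card U)"
    by (simp add: sum.If_cases Int_def)
  then have "int (card U) = int (CARD('a) * card {x \<in> U. B z x = 0})" by simp
  then show ?thesis by (simp only: of_nat_eq_iff)
qed

lemma card_functional_kernel_le:
  assumes "vec.subspace U"
  shows "card U \<le> CARD('a) * card {x \<in> U. B z x = 0}"
proof (cases "\<exists>y\<in>U. B z y \<noteq> 0")
  case True
  then show ?thesis using card_functional_kernel[OF assms] by auto
next
  case False
  then have "{x \<in> U. B z x = 0} = U" by auto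
  then show ?thesis by simp
qed

lemma ex_hyperbolic_pair:
  assumes "vec.subspace W" "no_singular_radical W" "p \<in> W" "Q p = 0" "p \<noteq> 0"
  shows "\<exists>p'. hyperbolic_pair W p p'"
proof -
  obtain y where y: "y \<in> W" "B p y \<noteq> 0" using assms unfolding no_singular_radical_def by blast
  define z where "z = inverse (B p y) *s y"
  have z: "z \<in> W" "B p z = 1" using y assms by (auto simp: z_def vec.subspace_scale)
  \<comment> \<open>Since \<open>Q p = 0\<close> and \<open>B z p = 1\<close>, subtracting
    \<open>c *s p\<close> lowers \<open>Q z\<close> by exactly \<open>c\<close>; hence
    \<open>c = Q z\<close> gives a singular vector in every characteristic.\<close>
  have "hyperbolic_pair W p (z - Q z *s p)"
    unfolding hyperbolic_pair_def
  proof (intro conjI)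
    have "Q (z + (- Q z) *s p) = Q z + (- Q z) * B z p"
      by (simp add: Q_add assms del: vec.scale_minus_left)
    then show "Q (z - Q z *s p) = 0" using z B_commute[of p z] by simp
  qed (use assms z in \<open>auto simp: vec.subspace_diff vec.subspace_scale B_self\<close>)
  then show ?thesis by blast
qed

lemma perp_component:
  assumes "hyperbolic_pair W p p'" "y \<in> W"
  shows "y - B p' y *s p - B p y *s p' \<in> perp_pair W p p'"
  using assms hyperbolic_pair_B[OF assms(1)]
  by (auto simp: perp_pair_def hyperbolic_pair_def vec.subspace_diff vec.subspace_scale)

lemma hyperbolic_notin_perp_pair: "hyperbolic_pair W p p' \<Longrightarrow> p \<notin> perp_pair W p p'"
  using hyperbolic_pair_B(3) by (auto simp: perp_pair_def)

lemma elliptic_on_0: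
  assumes "elliptic_on 0 W" "x \<in> W" "Q x = 0"
  shows "x = 0"
proof (rule ccontr)
  assume "x \<noteq> 0"
  have "totally_singular Q (vec.span {x})"
    using assms by (auto simp: totally_singular_def vec.span_singleton vec.subspace_span[of "{x}", unfolded vec.span_singleton])
  moreover have "vec.span {x} \<subseteq> W"
    using assms by (auto simp: elliptic_on_def vec.span_minimal)
  ultimately have "card (vec.span {x}) \<le> 1" using assms by (simp add: elliptic_on_def)
  moreover have "card {0, x} \<le> card (vec.span {x})"
    by (rule card_mono) (auto simp: vec.span_zero vec.span_base)
  ultimately show False using \<open>x \<noteq> 0\<close> by simp
qed

lemma elliptic_on_Suc_singular:
  assumes "elliptic_on (Suc k) W"
  shows "\<exists>p\<in>W. p \<noteq> 0 \<and> Q p = 0"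
proof -
  obtain U where U: "totally_singular Q U" "U \<subseteq> W" "card U = CARD('a) ^ Suc k"
    using assms by (auto simp: elliptic_on_def)
  have "CARD('a) > 1" using q_ge_2 by (simp add: q_def)
  then have "card U > 1" unfolding U(3) by (rule one_less_power) simp
  then have "\<not> U \<subseteq> {0}" using card_mono[of "{0}" U] by auto
  then show ?thesis using U by (auto simp: totally_singular_def)
qed

text \<open>Adjoining \<open>p\<close> to a totally singular subspace of the complement multiplies
  its size by \<open>CARD('a)\<close>, which gives the upper bound. For existence, a largest totally
  singular subspace through \<open>p\<close> is cut with the hyperplane orthogonal to
  \<open>p'\<close>.\<close>

lemma elliptic_on_perp_pair:
  assumes ell: "elliptic_on (Suc k) W" and hp: "hyperbolic_pair W p p'"
  shows "elliptic_on k (perp_pair W p p')"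
proof -
  let ?W' = "perp_pair W p p'"
  note h = hp[unfolded hyperbolic_pair_def] hyperbolic_pair_B[OF hp]
  have qpos: "CARD('a) > 0" by simp
  have sub': "vec.subspace ?W'" using h by (simp add: subspace_perp_pair)
  have rad: "no_singular_radical ?W'"
    unfolding no_singular_radical_def
  proof (intro ballI impI, elim conjE)
    fix x assume x: "x \<in> ?W'" "Q x = 0" "\<forall>y\<in>?W'. B x y = 0"
    have "B x y = 0" if "y \<in> W" for y
    proof -
      have "B x (y - B p' y *s p - B p y *s p') = 0" using x perp_component[OF hp that] by blast
      then show ?thesis using x B_commute[of x p] B_commute[of x p'] by (simp add: perp_pair_def)
    qed
    then show "x = 0" using ell x by (auto simp: elliptic_on_def no_singular_radical_def perp_pair_def)
  qed
  have card: "card ?W' = CARD('a) ^ (2 * k + 2)"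
  proof -
    have "int (card W) = q\<^sup>2 * q ^ (2 * k + 2)"
      using ell by (simp add: elliptic_on_def q_def power2_eq_square)
    then have "int (card ?W') = q ^ (2 * k + 2)"
      using card_perp_pair[OF hp] q_ge_2 by simp
    then show ?thesis unfolding q_def by (simp only: of_nat_power[symmetric] of_nat_eq_iff)
  qed
  have bound: "card U \<le> CARD('a) ^ k" if U: "totally_singular Q U" "U \<subseteq> ?W'" for U
  proof -
    have "totally_singular Q (extend_by p U)"
      using U h by (intro totally_singular_extend_by) (auto simp: perp_pair_def)
    moreover have "extend_by p U \<subseteq> W"
      using U h by (auto simp: extend_by_def perp_pair_def vec.subspace_add vec.subspace_scale)
    ultimately have "card (extend_by p U) \<le> CARD('a) ^ Suc k" using ell by (simp add: elliptic_on_def)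
    moreover have "card (extend_by p U) = CARD('a) * card U"
      using U hyperbolic_notin_perp_pair[OF hp] by (intro card_extend_by) (auto simp: totally_singular_def)
    ultimately show ?thesis by simp
  qed
  have contain: "\<exists>U'. totally_singular Q U' \<and> U' \<subseteq> ?W' \<and> card U' = CARD('a) ^ k"
    if U: "totally_singular Q U" "U \<subseteq> W" "card U = CARD('a) ^ Suc k" "p \<in> U" for U
  proof (intro exI conjI)
    let ?U' = "{x \<in> U. B p' x = 0}"
    show "totally_singular Q ?U'"
      using U by (auto simp: totally_singular_def vec.subspace_def)
    show "?U' \<subseteq> ?W'" using U totally_singular_B[OF U(1) U(4)] by (auto simp: perp_pair_def)
    have "card U = CARD('a) * card ?U'"
      using U h by (intro card_functional_kernel[of U p p']) (auto simp: totally_singular_def)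
    then show "card ?U' = CARD('a) ^ k" using U(3) by simp
  qed
  obtain U where U: "totally_singular Q U" "U \<subseteq> W" "card U = CARD('a) ^ Suc k"
    using ell by (auto simp: elliptic_on_def)
  have "\<exists>U'. totally_singular Q U' \<and> U' \<subseteq> ?W' \<and> card U' = CARD('a) ^ k"
  proof (cases "p \<in> U")
    case True
    then show ?thesis using contain U by blast
  next
    \<comment> \<open>Passing to \<open>?X\<close> loses at most a factor \<open>CARD('a)\<close>,
      which adjoining \<open>p\<close> restores; the upper bound on \<open>W\<close> then forces
      \<open>?Y\<close> to have maximal size, and it contains \<open>p\<close>.\<close>
    case False
    let ?X = "{x \<in> U. B p x = 0}"
    let ?Y = "extend_by p ?X"
    have X: "vec.subspace ?X" using U by (auto simp: totally_singular_def vec.subspace_def)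
    have tsY: "totally_singular Q ?Y"
      using X U h by (intro totally_singular_extend_by) (auto simp: totally_singular_def)
    have YW: "?Y \<subseteq> W"
      using U h by (auto simp: extend_by_def vec.subspace_add vec.subspace_scale)
    have "card ?Y = CARD('a) * card ?X" using X False by (intro card_extend_by) auto
    moreover have "card U \<le> CARD('a) * card ?X"
      using U by (intro card_functional_kernel_le) (auto simp: totally_singular_def)
    moreover have "card ?Y \<le> CARD('a) ^ Suc k" using ell tsY YW by (simp add: elliptic_on_def)
    ultimately have "card ?Y = CARD('a) ^ Suc k" using U by simp
    moreover have "p \<in> ?Y" using mem_extend_by[OF vec.subspace_0[OF X], of 1 p] by simp
    ultimately show ?thesis using contain tsY YW by blast
  qed
  then show ?thesis using sub' rad card bound by (auto simp: elliptic_on_def)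
qed

text \<open>In odd characteristic the radical of the polar form is totally singular. In
  characteristic 2 it could a priori be anisotropic of dimension 1; it then survives to the
  anisotropic plane at the end of the induction, where \<open>Q (y + c z) = Q y + c\<^sup>2 Q z\<close> is solvable
  because every element is a square.\<close>

lemma elliptic_on_nondegenerate:
  assumes "elliptic_on r W" "z \<in> W" "\<And>y. y \<in> W \<Longrightarrow> B z y = 0"
  shows "z = 0"
  using assms
proof (induction r arbitrary: W)
  case 0
  show ?case
  proof (rule ccontr)
    assume z: "z \<noteq> 0"
    have Qz: "Q z \<noteq> 0" using elliptic_on_0[OF 0(1,2)] z by auto
    \<comment> \<open>\<open>0 = B z z = 2 * Q z\<close> with \<open>Q z\<close> nonzero forces
      characteristic 2.\<close>
    have two: "(2::'a) = 0" using 0(3)[OF 0(2)] Qz by (simp add: B_self)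
    have sub: "vec.subspace W" using 0 by (simp add: elliptic_on_def)
    have "inj (\<lambda>c::'a. c\<^sup>2)"
    proof (rule injI)
      fix c d :: 'a assume "c\<^sup>2 = d\<^sup>2"
      then have "(c - d)\<^sup>2 = 2 * (d * (d - c))" by (simp add: power2_eq_square algebra_simps)
      then show "c = d" using two by simp
    qed
    then have surj: "surj (\<lambda>c::'a. c\<^sup>2)" by (simp add: finite_UNIV_inj_surj)
    have "card (range (\<lambda>c. c *s z)) \<le> CARD('a)" by (rule card_image_le) simp
    also have "\<dots> < CARD('a) ^ 2"
      using q_ge_2 by (simp add: q_def power2_eq_square)
    also have "\<dots> = card W" using 0 by (simp add: elliptic_on_def power2_eq_square)
    finally have "\<not> W \<subseteq> range (\<lambda>c. c *s z)" using card_mono[of "range (\<lambda>c. c *s z)" W] by auto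
    then obtain y where y: "y \<in> W" "y \<notin> range (\<lambda>c. c *s z)" by auto
    obtain c where c: "Q y / Q z = c\<^sup>2" using surj by (metis surjD)
    have "Q (y + c *s z) = Q y + c\<^sup>2 * Q z"
      using 0(3)[OF y(1)] B_commute[of y z] by (simp add: Q_add)
    also have "\<dots> = 2 * Q y" using Qz by (simp flip: c)
    finally have "Q (y + c *s z) = 0" using two by simp
    then have "y + c *s z = 0" 
      using elliptic_on_0[OF 0(1)] sub y 0(2) by (simp add: vec.subspace_add vec.subspace_scale)
    then have "y = (- c) *s z" by (simp add: add_eq_0_iff2)
    then show False using y by blast
  qed
next
  case (Suc k)
  obtain p where p: "p \<in> W" "p \<noteq> 0" "Q p = 0" using elliptic_on_Suc_singular[OF Suc.prems(1)] by blast
  obtain p' where hp: "hyperbolic_pair W p p'"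
    using ex_hyperbolic_pair p Suc.prems(1) unfolding elliptic_on_def by blast
  have "p' \<in> W" using hp by (simp add: hyperbolic_pair_def)
  then have "z \<in> perp_pair W p p'"
    using Suc.prems p B_commute[of z p] B_commute[of z p'] by (simp add: perp_pair_def)
  then show ?case
    using Suc.IH[OF elliptic_on_perp_pair[OF Suc.prems(1) hp]] Suc.prems by (auto simp: perp_pair_def)
qed

lemma ex_hyperbolic_pair_elliptic:
  assumes "elliptic_on r W" "p \<in> W" "Q p = 0" "p \<noteq> 0"
  shows "\<exists>p'. hyperbolic_pair W p p'"
  using assms ex_hyperbolic_pair unfolding elliptic_on_def by blast

section \<open>Counting singular vectors\<close>

lemma sum_affine_zero:
  "(\<Sum>a\<in>UNIV. if a * b + c = (0::'a) then 1 else (0::int)) =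
     (if b = 0 then (if c = 0 then q else 0) else 1)"
proof (cases "b = 0")
  case False
  have "(a * b + c = 0) = (a = - c / b)" for a
    using False by (auto simp: field_simps add_eq_0_iff2)
  then show ?thesis using False by simp
qed (simp add: q_def)

lemma sum_If_zero: 
  "(\<Sum>b\<in>UNIV. if b = (0::'a) then x else y) = x + (q - 1) * (y::int)"
proof -
  have "(\<Sum>b\<in>UNIV. if b = (0::'a) then x else y) = x + (\<Sum>b\<in>UNIV - {0::'a}. y)"
    by (subst sum.remove[of UNIV 0]) (auto intro!: sum.cong)
  then show ?thesis by (simp add: q_def of_nat_diff)
qed

text \<open>In hyperbolic coordinates the form is \<open>a * b + Q w\<close>. For
  \<open>b = 0\<close> the vector \<open>w\<close> must be singular and \<open>a\<close> is free;
  for each other \<open>b\<close> the coordinate \<open>a\<close> is determined by \<open>w\<close>.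
  The zero vector is counted.\<close>

lemma card_singular:
  assumes "elliptic_on r W"
  shows "(\<Sum>x\<in>W. if Q x = 0 then 1 else 0) = q ^ (2 * r + 1) - q ^ (r + 1) + q ^ r"
  using assms
proof (induction r arbitrary: W)
  case 0
  have "0 \<in> W" using 0 by (simp add: elliptic_on_def vec.subspace_0)
  then have "{x \<in> W. Q x = 0} = {0}" using elliptic_on_0[OF 0] by auto
  then show ?case by (simp add: sum.If_cases Int_def)
next
  case (Suc k)
  obtain p p' where hp: "hyperbolic_pair W p p'"
    using elliptic_on_Suc_singular[OF Suc.prems] ex_hyperbolic_pair_elliptic[OF Suc.prems] by blast
  let ?W' = "perp_pair W p p'"
  have card': "int (card ?W') = q ^ (2 * k + 2)"
    using elliptic_on_perp_pair[OF Suc.prems hp] by (simp add: elliptic_on_def q_def)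
  have "(\<Sum>x\<in>W. if Q x = 0 then 1 else 0) =
      (\<Sum>a\<in>UNIV. \<Sum>b\<in>UNIV. \<Sum>w\<in>?W'. if a * b + Q w = 0 then 1 else (0::int))"
    unfolding sum_hyperbolic_split[OF hp] by (intro sum.cong refl) (simp add: Q_split[OF hp])
  also have "\<dots> = (\<Sum>b\<in>UNIV. \<Sum>a\<in>UNIV. \<Sum>w\<in>?W'. if a * b + Q w = 0 then 1 else (0::int))"
    by (rule sum.swap)
  also have "\<dots> = (\<Sum>b\<in>UNIV. \<Sum>w\<in>?W'. \<Sum>a\<in>UNIV. if a * b + Q w = 0 then 1 else (0::int))"
    by (intro sum.cong refl sum.swap)
  also have "\<dots> = (\<Sum>b\<in>UNIV. if b = (0::'a) then q * (\<Sum>w\<in>?W'. if Q w = 0 then 1 else 0) else q ^ (2 * k + 2))"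
    unfolding sum_affine_zero
    by (intro sum.cong refl) (auto simp: card' sum_distrib_left intro!: sum.cong)
  also have "\<dots> = q * (q ^ (2 * k + 1) - q ^ (k + 1) + q ^ k) + (q - 1) * q ^ (2 * k + 2)"
    unfolding sum_If_zero Suc.IH[OF elliptic_on_perp_pair[OF Suc.prems hp]] ..
  also have "\<dots> = q ^ (2 * Suc k + 1) - q ^ (Suc k + 1) + q ^ Suc k"
    by (simp add: algebra_simps)
  finally show ?case .
qed

section \<open>Weighted ovoids\<close>

text \<open>A weight on points is encoded as a scalar-invariant function on vectors, so that every sum
  over points is multiplied by \<open>q - 1\<close>.\<close>

definition weighted_ovoid :: "('a ^ 'n) set \<Rightarrow> int \<Rightarrow> ('a ^ 'n \<Rightarrow> int) \<Rightarrow> bool" where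
  "weighted_ovoid W m f \<longleftrightarrow>
     (\<forall>c x. c \<noteq> 0 \<longrightarrow> f (c *s x) = f x) \<and>
     (\<forall>x. f x \<noteq> 0 \<longrightarrow> x \<in> W \<and> Q x = 0 \<and> x \<noteq> 0) \<and>
     (\<forall>U. generator_on W U \<longrightarrow> (\<Sum>x\<in>U. f x) = (q - 1) * m)"

text \<open>Here \<open>W'\<close> is a complement of \<open>p\<close> in \<open>p\<^sup>\<bottom>\<close> and stands for the quotient \<open>p\<^sup>\<bottom>/p\<close>.\<close>

definition project_weight :: "('a ^ 'n) set \<Rightarrow> 'a ^ 'n \<Rightarrow> ('a ^ 'n \<Rightarrow> int) \<Rightarrow> 'a ^ 'n \<Rightarrow> int" where
  "project_weight W' p f x = (if x \<in> W' \<and> x \<noteq> 0 then \<Sum>a\<in>UNIV. f (a *s p + x) else 0)"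

text \<open>A totally singular \<open>X\<close> containing \<open>p\<close> lies in
  \<open>p\<^sup>\<bottom>\<close>, so modulo multiples of \<open>p\<close> it reduces to
  \<open>X \<inter> ?W'\<close>, which equals \<open>U\<close> by maximality of
  \<open>U\<close>.\<close>

lemma generator_on_extend_by:
  assumes hp: "hyperbolic_pair W p p'" and gen: "generator_on (perp_pair W p p') U"
  shows "generator_on W (extend_by p U)"
  unfolding generator_on_def
proof (intro conjI allI impI; (elim conjE)?)
  let ?W' = "perp_pair W p p'"
  note h = hp[unfolded hyperbolic_pair_def] hyperbolic_pair_B[OF hp]
  have U: "totally_singular Q U" "U \<subseteq> ?W'" using gen by (auto simp: generator_on_def)
  show "totally_singular Q (extend_by p U)"
    using U h by (intro totally_singular_extend_by) (auto simp: perp_pair_def)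
  show "extend_by p U \<subseteq> W"
    using U h by (auto simp: extend_by_def perp_pair_def vec.subspace_add vec.subspace_scale)
  fix X assume X: "totally_singular Q X" "X \<subseteq> W" "extend_by p U \<subseteq> X"
  have subX: "vec.subspace X" using X by (simp add: totally_singular_def)
  have subU: "vec.subspace U" using U by (simp add: totally_singular_def)
  have pX: "p \<in> X" using mem_extend_by[OF vec.subspace_0[OF subU], of 1 p] X by auto
  have "totally_singular Q (X \<inter> ?W')"
    using X subspace_perp_pair[of W p p'] h by (auto simp: totally_singular_def vec.subspace_inter)
  moreover have "U \<subseteq> X \<inter> ?W'" using U X mem_extend_by[of _ U 0 p] by auto
  ultimately have eq: "X \<inter> ?W' = U" using gen by (simp add: generator_on_def)
  have "x \<in> extend_by p U" if x: "x \<in> X" for x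
  proof -
    have b: "B p x = 0" using totally_singular_B[OF X(1) pX x] .
    have "x - B p' x *s p \<in> ?W'" using perp_component[OF hp, of x] X x b by auto
    moreover have "x - B p' x *s p \<in> X" using subX pX x by (simp add: vec.subspace_diff vec.subspace_scale)
    ultimately have "x - B p' x *s p \<in> U" using eq by blast
    from mem_extend_by[OF this, of "B p' x" p] show ?thesis by simp
  qed
  then show "X = extend_by p U" using X by blast
qed

section \<open>Projecting a weight from a singular point\<close>

lemma weight_scale: "weighted_ovoid W m f \<Longrightarrow> c \<noteq> 0 \<Longrightarrow> f (c *s x) = f x"
  by (simp add: weighted_ovoid_def)

lemma weight_zero: "weighted_ovoid W m f \<Longrightarrow> f 0 = 0"
  by (auto simp: weighted_ovoid_def)

lemma sum_weight_line:
  assumes "weighted_ovoid W m f"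
  shows "(\<Sum>a\<in>UNIV. f (a *s x)) = (q - 1) * f x"
proof -
  have "(\<Sum>a\<in>UNIV. f (a *s x)) = (\<Sum>a\<in>UNIV. if a = (0::'a) then 0 else f x)"
    by (intro sum.cong) (auto simp: weight_scale[OF assms] weight_zero[OF assms])
  then show ?thesis by (simp add: sum_If_zero)
qed

lemma project_weight_scale:
  assumes W': "vec.subspace W'" and scale: "\<And>c x. c \<noteq> 0 \<Longrightarrow> f (c *s x) = f x" and c: "c \<noteq> 0"
  shows "project_weight W' p f (c *s x) = project_weight W' p f x"
proof -
  have "bij (\<lambda>a. c * a)" using c
    by (intro bij_betw_byWitness[where f' = "\<lambda>a. a / c"]) auto
  then have "(\<Sum>a\<in>UNIV. f (a *s p + c *s x)) = (\<Sum>a\<in>UNIV. f ((c * a) *s p + c *s x))"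
    by (rule sum.reindex_bij_betw[symmetric])
  also have "\<dots> = (\<Sum>a\<in>UNIV. f (c *s (a *s p + x)))"
    by (simp add: vec.scale_right_distrib)
  also have "\<dots> = (\<Sum>a\<in>UNIV. f (a *s p + x))" using c by (simp add: scale)
  finally have "(\<Sum>a\<in>UNIV. f (a *s p + c *s x)) = (\<Sum>a\<in>UNIV. f (a *s p + x))" .
  moreover have "c *s x \<in> W' \<longleftrightarrow> x \<in> W'"
    using vec.subspace_scale[OF W', of x c] vec.subspace_scale[OF W', of "c *s x" "inverse c"] c by auto
  ultimately show ?thesis using c by (simp add: project_weight_def)
qed

context
  fixes W :: "('a ^ 'n) set" and p p' :: "'a ^ 'n" and m :: int and f :: "'a ^ 'n \<Rightarrow> int"
  assumes hp: "hyperbolic_pair W p p'" and ov: "weighted_ovoid W m f"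
begin

lemmas hyperbolic_facts = hp[unfolded hyperbolic_pair_def] hyperbolic_pair_B[OF hp]

text \<open>The projected weight is set to zero at \<open>u = 0\<close>, so the vectors on the line
  of \<open>p\<close> enter through the separate term \<open>(q - 1) * f p\<close>.\<close>

lemma sum_extended_weight:
  assumes "vec.subspace U" "U \<subseteq> perp_pair W p p'"
  shows "(\<Sum>a\<in>UNIV. \<Sum>u\<in>U. f (a *s p + u)) = (q - 1) * f p + (\<Sum>u\<in>U. project_weight (perp_pair W p p') p f u)"
proof -
  have "(\<Sum>a\<in>UNIV. \<Sum>u\<in>U. f (a *s p + u)) = (\<Sum>u\<in>U. \<Sum>a\<in>UNIV. f (a *s p + u))"
    by (rule sum.swap)
  also have "\<dots> = (\<Sum>u\<in>U. (if u = 0 then (q - 1) * f p else 0) + project_weight (perp_pair W p p') p f u)"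
    using assms by (intro sum.cong) (auto simp: project_weight_def sum_weight_line[OF ov])
  also have "\<dots> = (q - 1) * f p + (\<Sum>u\<in>U. project_weight (perp_pair W p p') p f u)"
    using vec.subspace_0[OF assms(1)] by (simp add: sum.distrib sum.delta)
  finally show ?thesis .
qed

lemma sum_weight_perp:
  "(\<Sum>x\<in>W. if B p x = 0 then f x else 0) =
     (q - 1) * f p + (\<Sum>u\<in>perp_pair W p p'. project_weight (perp_pair W p p') p f u)"
proof -
  let ?W' = "perp_pair W p p'"
  have "(\<Sum>x\<in>W. if B p x = 0 then f x else 0) =
      (\<Sum>a\<in>UNIV. \<Sum>b\<in>UNIV. \<Sum>w\<in>?W'. if b = (0::'a) then f (a *s p + w) else 0)"
    unfolding sum_hyperbolic_split[OF hp]
    by (intro sum.cong refl) (use hyperbolic_facts in \<open>auto simp: perp_pair_def\<close>)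
  also have "\<dots> = (\<Sum>a\<in>UNIV. \<Sum>b\<in>(UNIV :: 'a set). if b = 0 then \<Sum>w\<in>?W'. f (a *s p + w) else 0)"
    by (intro sum.cong refl) auto
  also have "\<dots> = (\<Sum>a\<in>UNIV. \<Sum>w\<in>?W'. f (a *s p + w))" by simp
  finally show ?thesis using hyperbolic_facts by (simp add: sum_extended_weight subspace_perp_pair)
qed

text \<open>Adjoining \<open>p\<close> to a generator of the complement gives a generator of
  \<open>W\<close> through \<open>p\<close>. Its sum is \<open>(q - 1) * m\<close>, and the point
  \<open>p\<close> accounts for \<open>(q - 1) * f p\<close> of it.\<close>

lemma project_weight_ovoid:
  "weighted_ovoid (perp_pair W p p') (m - f p) (project_weight (perp_pair W p p') p f)"
  unfolding weighted_ovoid_def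
proof (intro conjI allI impI)
  let ?W' = "perp_pair W p p'"
  show "project_weight ?W' p f (c *s x) = project_weight ?W' p f x" if "c \<noteq> 0" for c x
    using that hyperbolic_facts by (intro project_weight_scale weight_scale[OF ov]) (auto simp: subspace_perp_pair)
  fix x assume nz: "project_weight ?W' p f x \<noteq> 0"
  then show x: "x \<in> ?W'" "x \<noteq> 0" by (auto simp: project_weight_def split: if_splits)
  obtain a where "f (a *s p + x) \<noteq> 0"
    using nz by (auto simp: project_weight_def split: if_splits elim: sum.not_neutral_contains_not_neutral)
  then have "Q (a *s p + x) = 0" using ov by (auto simp: weighted_ovoid_def)
  then show "Q x = 0" using Q_split[OF hp x(1), of a 0] by simp
next
  let ?W' = "perp_pair W p p'"
  fix U assume gen: "generator_on ?W' U"
  have U: "vec.subspace U" "U \<subseteq> ?W'" using gen by (auto simp: generator_on_def totally_singular_def)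
  have "(q - 1) * m = (\<Sum>x\<in>extend_by p U. f x)"
    using ov generator_on_extend_by[OF hp gen] by (simp add: weighted_ovoid_def)
  also have "\<dots> = (\<Sum>a\<in>UNIV. \<Sum>u\<in>U. f (a *s p + u))"
    using U hyperbolic_notin_perp_pair[OF hp] by (intro sum_extend_by) auto
  also have "\<dots> = (q - 1) * f p + (\<Sum>u\<in>U. project_weight ?W' p f u)"
    using U by (rule sum_extended_weight)
  finally show "(\<Sum>x\<in>U. project_weight ?W' p f x) = (q - 1) * (m - f p)"
    by (simp add: algebra_simps)
qed

end

text \<open>On \<open>p\<^sup>\<bottom>\<close> the coordinate \<open>b\<close> vanishes and the
  form reduces to \<open>Q w\<close>, so \<open>a\<close> is free; this is the factor
  \<open>q\<close>.\<close>

lemma card_singular_perp: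
  assumes ell: "elliptic_on (Suc k) W" and hp: "hyperbolic_pair W p p'"
  shows "(\<Sum>x\<in>W. if B p x = 0 \<and> Q x = 0 then 1 else 0) = q * (q ^ (2 * k + 1) - q ^ (k + 1) + q ^ k)"
proof -
  let ?W' = "perp_pair W p p'"
  note h = hp[unfolded hyperbolic_pair_def] hyperbolic_pair_B[OF hp]
  have "(\<Sum>x\<in>W. if B p x = 0 \<and> Q x = 0 then 1 else 0) =
      (\<Sum>a\<in>(UNIV::'a set). \<Sum>b\<in>UNIV. \<Sum>w\<in>?W'. if b = (0::'a) \<and> Q w = 0 then 1 else (0::int))"
    unfolding sum_hyperbolic_split[OF hp]
  proof (intro sum.cong refl)
    fix a b :: 'a and w assume w: "w \<in> ?W'"
    have "B p (a *s p + b *s p' + w) = b" using h w by (auto simp: perp_pair_def)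
    then show "(if B p (a *s p + b *s p' + w) = 0 \<and> Q (a *s p + b *s p' + w) = 0 then 1 else 0) =
       (if b = 0 \<and> Q w = 0 then 1 else (0::int))"
      using Q_split[OF hp w, of a b] by auto
  qed
  also have "\<dots> = q * (\<Sum>b\<in>UNIV. if b = (0::'a) then \<Sum>w\<in>?W'. if Q w = 0 then 1 else (0::int) else 0)"
  proof -
    have "(\<Sum>w\<in>?W'. if b = 0 \<and> Q w = 0 then 1 else (0::int)) =
        (if b = 0 then \<Sum>w\<in>?W'. if Q w = 0 then 1 else 0 else 0)" for b :: 'a
      by simp
    then show ?thesis by (simp add: q_def)
  qed
  also have "\<dots> = q * (q ^ (2 * k + 1) - q ^ (k + 1) + q ^ k)"
    using card_singular[OF elliptic_on_perp_pair[OF ell hp]] by simp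
  finally show ?thesis .
qed

text \<open>Orthogonal pairs of singular vectors \<open>z\<close>, \<open>x\<close> are counted with
  weight \<open>f x\<close>. Fixing \<open>z\<close> uses the statement for the projection from
  \<open>z\<close>; fixing \<open>x\<close> uses the number of singular vectors in
  \<open>x\<^sup>\<bottom>\<close>. In rank 0 the only generator is \<open>{0}\<close>, which forces
  \<open>m = 0\<close>.\<close>

lemma total_weight:
  assumes "elliptic_on r W" "weighted_ovoid W m f"
  shows "(\<Sum>x\<in>W. f x) = (q - 1) * m * (q ^ (r + 1) + 1)"
  using assms
proof (induction r arbitrary: W m f)
  case 0
  have W: "vec.subspace W" using 0 by (simp add: elliptic_on_def)
  have "generator_on W {0}"
    using W elliptic_on_0[OF 0(1)]
    by (auto simp: generator_on_def totally_singular_def vec.subspace_0 vec.subspace_single_0)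
  then have "(\<Sum>x\<in>{0}. f x) = (q - 1) * m" using 0(2) unfolding weighted_ovoid_def by blast
  then have "(q - 1) * m = 0" using weight_zero[OF 0(2)] by simp
  moreover have "(\<Sum>x\<in>W. f x) = 0"
    using 0(2) elliptic_on_0[OF 0(1)] by (intro sum.neutral) (auto simp: weighted_ovoid_def)
  ultimately show ?case by simp
next
  case (Suc k)
  \<comment> \<open>\<open>M\<close> is the number of singular vectors in rank \<open>k\<close>,
    zero included.\<close>
  define X t M where "X = q ^ k" and "t = (\<Sum>x\<in>W. f x)" and "M = q * X\<^sup>2 - q * X + X"
  have M: "q ^ (2 * k + 1) - q ^ (k + 1) + q ^ k = M"
    by (simp add: M_def X_def power_mult power2_eq_square power_add flip: power_mult_distrib)
  let ?S = "\<lambda>z. z \<in> W \<and> Q z = 0 \<and> z \<noteq> 0"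
  have fS: "?S x" if "f x \<noteq> 0" for x using that Suc.prems(2) by (auto simp: weighted_ovoid_def)
  have pair: "\<exists>z'. hyperbolic_pair W z z'" if "?S z" for z
    using that ex_hyperbolic_pair_elliptic[OF Suc.prems(1)] by blast
  have N: "(\<Sum>z\<in>W. if ?S z then 1 else 0) = q ^ 3 * X\<^sup>2 - q\<^sup>2 * X + q * X - 1"
  proof -
    have W0: "0 \<in> W" using Suc.prems by (simp add: elliptic_on_def vec.subspace_0)
    have "(\<Sum>z\<in>W. if Q z = 0 then 1 else 0) = (\<Sum>z\<in>W. (if ?S z then 1 else 0) + (if z = 0 then 1 else (0::int)))"
      by (intro sum.cong) auto
    also have "\<dots> = (\<Sum>z\<in>W. if ?S z then 1 else 0) + 1" using W0 by (simp add: sum.distrib)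
    finally have "(\<Sum>z\<in>W. if ?S z then 1 else 0) + 1 = q ^ (2 * Suc k + 1) - q ^ (Suc k + 1) + q ^ Suc k"
      using card_singular[OF Suc.prems(1)] by simp
    also have "\<dots> = q ^ 3 * X\<^sup>2 - q\<^sup>2 * X + q * X"
      by (simp add: X_def power2_eq_square power3_eq_cube power_add mult_2)
    finally show ?thesis by simp
  qed
  have row: "(\<Sum>x\<in>W. if B z x = 0 then f x else 0) = (q - 1) * m * (q * X + 1) - (q - 1) * q * X * f z"
    if z: "?S z" for z
  proof -
    obtain z' where hp: "hyperbolic_pair W z z'" using pair z by blast
    have "(\<Sum>u\<in>perp_pair W z z'. project_weight (perp_pair W z z') z f u) = (q - 1) * (m - f z) * (q ^ (k + 1) + 1)"
      by (rule Suc.IH[OF elliptic_on_perp_pair[OF Suc.prems(1) hp] project_weight_ovoid[OF hp Suc.prems(2)]])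
    then show ?thesis unfolding sum_weight_perp[OF hp Suc.prems(2)] by (simp add: X_def algebra_simps)
  qed
  have col: "(\<Sum>z\<in>W. if ?S z \<and> B z x = 0 then 1 else 0) = q * M - 1" if x: "?S x" for x
  proof -
    obtain x' where hp: "hyperbolic_pair W x x'" using pair x by blast
    have W0: "0 \<in> W" using Suc.prems by (simp add: elliptic_on_def vec.subspace_0)
    have "q * M = (\<Sum>z\<in>W. if B x z = 0 \<and> Q z = 0 then 1 else 0)"
      unfolding card_singular_perp[OF Suc.prems(1) hp] M ..
    also have "\<dots> = (\<Sum>z\<in>W. (if ?S z \<and> B z x = 0 then 1 else 0) + (if z = 0 then 1 else (0::int)))"
      by (intro sum.cong) (auto simp: B_commute[of _ x])
    also have "\<dots> = (\<Sum>z\<in>W. if ?S z \<and> B z x = 0 then 1 else 0) + 1" using W0 by (simp add: sum.distrib)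
    finally show ?thesis by simp
  qed
  have "(\<Sum>z\<in>W. \<Sum>x\<in>W. if ?S z \<and> B z x = 0 then f x else 0) =
      (\<Sum>z\<in>W. (q - 1) * m * (q * X + 1) * (if ?S z then 1 else 0) - (q - 1) * q * X * f z)"
  proof (intro sum.cong refl)
    fix z assume "z \<in> W"
    show "(\<Sum>x\<in>W. if ?S z \<and> B z x = 0 then f x else 0) =
      (q - 1) * m * (q * X + 1) * (if ?S z then 1 else 0) - (q - 1) * q * X * f z"
    proof (cases "?S z")
      case True
      then show ?thesis using row[OF True] by simp
    next
      case False
      then have "f z = 0" using fS by blast
      moreover have "(\<Sum>x\<in>W. if ?S z \<and> B z x = 0 then f x else 0) = 0" using False by (intro sum.neutral) auto
      ultimately show ?thesis using False by (simp only: if_False)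
    qed
  qed
  also have "\<dots> = (q - 1) * m * (q * X + 1) * (q ^ 3 * X\<^sup>2 - q\<^sup>2 * X + q * X - 1) - (q - 1) * q * X * t"
    unfolding sum_subtractf sum_distrib_left[symmetric] N t_def ..
  finally have 1: "(\<Sum>z\<in>W. \<Sum>x\<in>W. if ?S z \<and> B z x = 0 then f x else 0) =
    (q - 1) * m * (q * X + 1) * (q ^ 3 * X\<^sup>2 - q\<^sup>2 * X + q * X - 1) - (q - 1) * q * X * t" .
  have "(\<Sum>z\<in>W. \<Sum>x\<in>W. if ?S z \<and> B z x = 0 then f x else 0) =
      (\<Sum>x\<in>W. \<Sum>z\<in>W. f x * (if ?S z \<and> B z x = 0 then 1 else 0))"
    by (subst sum.swap) (intro sum.cong refl, simp)
  also have "\<dots> = (\<Sum>x\<in>W. f x * (q * M - 1))"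
  proof (intro sum.cong refl)
    fix x show "(\<Sum>z\<in>W. f x * (if ?S z \<and> B z x = 0 then 1 else 0)) = f x * (q * M - 1)"
    proof (cases "f x = 0")
      case False
      from col[OF fS[OF False]] show ?thesis by (simp only: sum_distrib_left[symmetric])
    qed simp
  qed
  also have "\<dots> = t * (q * M - 1)" by (simp add: t_def sum_distrib_right)
  finally have 2: "t * (q * M - 1) =
    (q - 1) * m * (q * X + 1) * (q ^ 3 * X\<^sup>2 - q\<^sup>2 * X + q * X - 1) - (q - 1) * q * X * t"
    using 1 by simp
  \<comment> \<open>The two counts give a linear equation for \<open>t\<close>; collecting its terms
    leaves a coefficient that is nonzero because \<open>q * X \<ge> 2\<close>.\<close>
  have "t * ((q * X)\<^sup>2 - 1) = ((q - 1) * m * (q\<^sup>2 * X + 1)) * ((q * X)\<^sup>2 - 1)"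
    using 2 unfolding M_def by (simp add: algebra_simps power2_eq_square power3_eq_cube)
  moreover have "(q * X)\<^sup>2 - 1 \<noteq> 0"
  proof -
    have "X \<ge> 1" using q_ge_2 by (simp add: X_def)
    then have "q * X \<ge> 2 * 1" using q_ge_2 by (intro mult_mono) auto
    then have "(q * X)\<^sup>2 \<ge> 2\<^sup>2" by (intro power_mono) auto
    then show ?thesis by simp
  qed
  ultimately have "t = (q - 1) * m * (q\<^sup>2 * X + 1)" by simp
  then show ?case by (simp add: t_def X_def power2_eq_square)
qed

section \<open>Hyperplane sums\<close>

lemma q_card: "int CARD('a) = q"
  by (simp add: q_def)

lemma elliptic_on_card: "elliptic_on r W \<Longrightarrow> int (card W) = q ^ (2 * r + 2)"
  by (simp add: elliptic_on_def q_def)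

lemma ex_dual_vector:
  assumes "elliptic_on r W" "x \<in> W" "x \<noteq> 0"
  shows "\<exists>z\<in>W. B x z = 1"
proof -
  obtain y where y: "y \<in> W" "B x y \<noteq> 0" using elliptic_on_nondegenerate assms by blast
  then show ?thesis using assms(1)
    by (intro bexI[of _ "inverse (B x y) *s y"]) (auto simp: elliptic_on_def vec.subspace_scale)
qed

lemma sum_functional:
  assumes "elliptic_on r W" "x \<in> W" "x \<noteq> 0"
  shows "(\<Sum>z\<in>W. g (B x z)) = q ^ (2 * r + 1) * (\<Sum>a\<in>UNIV. g a)"
proof -
  have W: "vec.subspace W" using assms by (simp add: elliptic_on_def)
  obtain y where y: "y \<in> W" "B x y = 1" using ex_dual_vector assms by blast
  have "int CARD('a) * (\<Sum>z\<in>W. g (B x z)) = int (card W) * (\<Sum>a\<in>UNIV. g a)"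
  proof (rule sum_surj_additive)
    fix b show "\<exists>z\<in>W. B x z = b"
      using y W by (intro bexI[of _ "b *s y"]) (auto simp: vec.subspace_scale)
  qed (use W in \<open>auto simp: vec.subspace_add vec.subspace_neg\<close>)
  then show ?thesis using q_ge_2 by (simp add: q_card elliptic_on_card[OF assms(1)])
qed

text \<open>For linearly independent \<open>x\<close> and \<open>y\<close> the pair
  \<open>(B x z, B y z)\<close> takes every value equally often, because nondegeneracy makes this
  map surjective.\<close>

lemma sum_functional_pair:
  assumes ell: "elliptic_on r W" and x: "x \<in> W" "x \<noteq> 0" and y: "y \<in> W" and ind: "\<And>c. y \<noteq> c *s x"
  shows "(\<Sum>z\<in>W. g (B x z) (B y z)) = q ^ (2 * r) * (\<Sum>a\<in>UNIV. \<Sum>b\<in>UNIV. g a b)"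
proof -
  have W: "vec.subspace W" using ell by (simp add: elliptic_on_def)
  obtain x1 where x1: "x1 \<in> W" "B x x1 = 1" using ex_dual_vector ell x by blast
  \<comment> \<open>\<open>y'\<close> is chosen orthogonal to \<open>x1\<close>, so that correcting
    \<open>x2\<close> by a multiple of \<open>x1\<close> keeps the pairing with \<open>y'\<close>
    equal to 1; the result \<open>u\<close> is dual to \<open>y\<close> and orthogonal to
    \<open>x\<close>.\<close>
  define y' where "y' = y - B y x1 *s x"
  have "y' \<in> W" using W x y by (simp add: y'_def vec.subspace_diff vec.subspace_scale)
  moreover have "y' \<noteq> 0" using ind by (simp add: y'_def)
  ultimately obtain x2 where x2: "x2 \<in> W" "B y' x2 = 1" using ex_dual_vector ell by blast
  define u where "u = x2 - B x x2 *s x1"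
  have u: "u \<in> W" "B x u = 0" "B y u = 1"
    using W x1 x2 by (auto simp: u_def y'_def vec.subspace_diff vec.subspace_scale algebra_simps)
  have "int CARD('a \<times> 'a) * (\<Sum>z\<in>W. (\<lambda>(a, b). g a b) (B x z, B y z)) = int (card W) * (\<Sum>c\<in>UNIV. (\<lambda>(a, b). g a b) c)"
  proof (rule sum_surj_additive)
    fix c :: "'a \<times> 'a"
    obtain a b where c: "c = (a, b)" by force
    have "a *s x1 + (b - a * B y x1) *s u \<in> W" using W x1 u by (simp add: vec.subspace_add vec.subspace_scale)
    then show "\<exists>z\<in>W. (B x z, B y z) = c"
      using x1 u by (intro bexI[of _ "a *s x1 + (b - a * B y x1) *s u"]) (auto simp: c)
  qed (use W in \<open>auto simp: vec.subspace_add vec.subspace_neg\<close>)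
  then have "q\<^sup>2 * (\<Sum>z\<in>W. g (B x z) (B y z)) = q ^ (2 * r + 2) * (\<Sum>a\<in>UNIV. \<Sum>b\<in>UNIV. g a b)"
    by (simp add: q_card elliptic_on_card[OF ell] power2_eq_square sum.cartesian_product case_prod_unfold)
  then show ?thesis using q_ge_2 by (simp add: power2_eq_square)
qed

text \<open>A Parseval identity. It is applied with \<open>F x b = (if b = 0 then f x else 0)\<close>, giving the
  second moment of the hyperplane sums of \<open>f\<close>, and with \<open>F w b = f (w - b *s p)\<close>.\<close>

context
  fixes W :: "('a ^ 'n) set" and r :: nat and F :: "'a ^ 'n \<Rightarrow> 'a \<Rightarrow> int"
  assumes ell: "elliptic_on r W" and F0: "\<And>b. F 0 b = 0"
    and Fc: "\<And>c x b. c \<noteq> 0 \<Longrightarrow> F (c *s x) (c * b) = F x b"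
begin

text \<open>For nonzero \<open>x\<close> the value \<open>B x z\<close> is equidistributed as
  \<open>z\<close> runs over \<open>W\<close>; the term \<open>x = 0\<close> vanishes by
  \<open>F0\<close>.\<close>

lemma sum_first_moment:
  "(\<Sum>z\<in>W. \<Sum>x\<in>W. F x (B x z)) = q ^ (2 * r + 1) * (\<Sum>x\<in>W. \<Sum>a\<in>UNIV. F x a)"
proof -
  have "(\<Sum>z\<in>W. \<Sum>x\<in>W. F x (B x z)) = (\<Sum>x\<in>W. \<Sum>z\<in>W. F x (B x z))" by (rule sum.swap)
  also have "\<dots> = (\<Sum>x\<in>W. q ^ (2 * r + 1) * (\<Sum>a\<in>UNIV. F x a))"
  proof (intro sum.cong refl)
    fix x assume "x \<in> W"
    then show "(\<Sum>z\<in>W. F x (B x z)) = q ^ (2 * r + 1) * (\<Sum>a\<in>UNIV. F x a)"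
      by (cases "x = 0") (simp_all add: F0 sum_functional[OF ell])
  qed
  finally show ?thesis by (simp add: sum_distrib_left)
qed

lemma F_total_scale:
  assumes "c \<noteq> 0"
  shows "(\<Sum>a\<in>UNIV. F (c *s x) a) = (\<Sum>a\<in>UNIV. F x a)"
proof -
  have "bij (\<lambda>a. c * a)" using assms
    by (intro bij_betw_byWitness[where f' = "\<lambda>a. a / c"]) auto
  then have "(\<Sum>a\<in>UNIV. F (c *s x) a) = (\<Sum>a\<in>UNIV. F (c *s x) (c * a))"
    by (rule sum.reindex_bij_betw[symmetric])
  then show ?thesis using assms by (simp add: Fc)
qed

text \<open>Expanding the square gives pairs \<open>x\<close>, \<open>y\<close>. Independent pairs
  contribute the product of their totals by equidistribution; on proportional pairs the homogeneity
  \<open>Fc\<close> makes both factors equal, which yields a diagonal correction.\<close>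

lemma sum_second_moment:
  "(\<Sum>z\<in>W. (\<Sum>x\<in>W. F x (B x z))\<^sup>2) =
     q ^ (2 * r) * ((\<Sum>x\<in>W. \<Sum>a\<in>UNIV. F x a)\<^sup>2
       - (q - 1) * (\<Sum>x\<in>W. (\<Sum>a\<in>UNIV. F x a)\<^sup>2)
       + q * (q - 1) * (\<Sum>x\<in>W. \<Sum>a\<in>UNIV. (F x a)\<^sup>2))"
proof -
  define S where "S x = (\<Sum>a\<in>UNIV. F x a)" for x
  define R where "R x = (\<Sum>a\<in>UNIV. (F x a)\<^sup>2)" for x
  define L where "L x = (\<lambda>c. c *s x) ` (UNIV - {0})" for x :: "'a ^ 'n"
  have W: "vec.subspace W" using ell by (simp add: elliptic_on_def)
  \<comment> \<open>The first summand is the contribution of an independent pair; the second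
    corrects it when \<open>y\<close> is a nonzero multiple of \<open>x\<close>.\<close>
  have entry: "(\<Sum>z\<in>W. F x (B x z) * F y (B y z)) =
      q ^ (2 * r) * (S x * S y) + (if y \<in> L x then q ^ (2 * r) * (q * R x - (S x)\<^sup>2) else 0)"
    if x: "x \<in> W" and y: "y \<in> W" for x y
  proof (cases "x = 0")
    case True
    then show ?thesis by (simp add: S_def R_def F0)
  next
    case x0: False
    show ?thesis
    proof (cases "y \<in> L x")
      case True
      then obtain c where c: "c \<noteq> 0" "y = c *s x" by (auto simp: L_def)
      have "(\<Sum>z\<in>W. F x (B x z) * F y (B y z)) = (\<Sum>z\<in>W. (F x (B x z))\<^sup>2)"
        using c by (simp add: Fc power2_eq_square)
      also have "\<dots> = q ^ (2 * r + 1) * R x"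
        unfolding R_def using sum_functional[OF ell x x0, of "\<lambda>a. (F x a)\<^sup>2"] .
      finally show ?thesis using True F_total_scale[OF c(1), of x] c
        by (simp add: S_def power2_eq_square algebra_simps)
    next
      case notL: False
      show ?thesis
      proof (cases "y = 0")
        case True
        then show ?thesis using notL by (simp add: S_def F0)
      next
        case False
        then have "y \<noteq> c *s x" for c using notL by (auto simp: L_def)
        from sum_functional_pair[OF ell x x0 y this, of "\<lambda>a b. F x a * F y b"]
        have "(\<Sum>z\<in>W. F x (B x z) * F y (B y z)) = q ^ (2 * r) * (\<Sum>a\<in>UNIV. \<Sum>b\<in>UNIV. F x a * F y b)" .
        then show ?thesis using notL by (simp add: S_def sum_product)
      qed
    qed
  qed
  have line: "(\<Sum>y\<in>W. if y \<in> L x then q ^ (2 * r) * (q * R x - (S x)\<^sup>2) else 0) =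
      (q - 1) * (q ^ (2 * r) * (q * R x - (S x)\<^sup>2))" if x: "x \<in> W" for x
  proof (cases "x = 0")
    case True
    then have "q ^ (2 * r) * (q * R x - (S x)\<^sup>2) = 0" by (simp add: S_def R_def F0)
    then show ?thesis by (simp only:) simp
  next
    case False
    have "L x \<subseteq> W" using W x by (auto simp: L_def vec.subspace_scale)
    then have "{y \<in> W. y \<in> L x} = L x" by blast
    moreover have "int (card (L x)) = q - 1"
      unfolding L_def using False
      by (subst card_image) (auto simp: inj_on_def q_def of_nat_diff)
    ultimately show ?thesis by (simp add: sum.If_cases Int_def)
  qed
  have "(\<Sum>z\<in>W. (\<Sum>x\<in>W. F x (B x z))\<^sup>2) = (\<Sum>z\<in>W. \<Sum>x\<in>W. \<Sum>y\<in>W. F x (B x z) * F y (B y z))"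
    by (simp add: power2_eq_square sum_product)
  also have "\<dots> = (\<Sum>x\<in>W. \<Sum>z\<in>W. \<Sum>y\<in>W. F x (B x z) * F y (B y z))" by (rule sum.swap)
  also have "\<dots> = (\<Sum>x\<in>W. \<Sum>y\<in>W. \<Sum>z\<in>W. F x (B x z) * F y (B y z))"
    by (intro sum.cong refl sum.swap)
  also have "\<dots> = (\<Sum>x\<in>W. \<Sum>y\<in>W. q ^ (2 * r) * (S x * S y) +
      (if y \<in> L x then q ^ (2 * r) * (q * R x - (S x)\<^sup>2) else 0))"
    by (intro sum.cong refl entry)
  also have "\<dots> = (\<Sum>x\<in>W. q ^ (2 * r) * (S x * (\<Sum>y\<in>W. S y)) + (q - 1) * (q ^ (2 * r) * (q * R x - (S x)\<^sup>2)))"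
    by (simp only: sum.distrib line sum_distrib_left cong: sum.cong)
  also have "\<dots> = q ^ (2 * r) * ((\<Sum>x\<in>W. S x)\<^sup>2 - (q - 1) * (\<Sum>x\<in>W. (S x)\<^sup>2) + q * (q - 1) * (\<Sum>x\<in>W. R x))"
  proof -
    have "(\<Sum>x\<in>W. q ^ (2 * r) * (S x * (\<Sum>y\<in>W. S y)) + (q - 1) * (q ^ (2 * r) * (q * R x - (S x)\<^sup>2))) =
        (\<Sum>x\<in>W. q ^ (2 * r) * (\<Sum>y\<in>W. S y) * S x + q ^ (2 * r) * (q - 1) * q * R x
          - q ^ (2 * r) * (q - 1) * (S x)\<^sup>2)"
      by (intro sum.cong refl) (simp add: algebra_simps)
    also have "\<dots> = q ^ (2 * r) * (\<Sum>y\<in>W. S y) * (\<Sum>x\<in>W. S x) + q ^ (2 * r) * (q - 1) * q * (\<Sum>x\<in>W. R x)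
          - q ^ (2 * r) * (q - 1) * (\<Sum>x\<in>W. (S x)\<^sup>2)"
      by (simp only: sum.distrib sum_subtractf sum_distrib_left[symmetric])
    finally show ?thesis by (simp add: power2_eq_square algebra_simps)
  qed
  finally show ?thesis by (simp add: S_def R_def)
qed

end

text \<open>The hyperplanes \<open>z\<^sup>\<bottom>\<close> with \<open>z\<close> singular account for the whole variance of the
  hyperplane sums, so the sum over a nonsingular hyperplane equals the mean value.\<close>

lemma hyperplane_weight:
  assumes ell: "elliptic_on r W" and ov: "weighted_ovoid W m f" and z: "z \<in> W" "z \<noteq> 0"
  shows "(\<Sum>x\<in>W. if B z x = 0 then f x else 0) = (q - 1) * m * (q ^ r + 1) - q ^ r * (q - 1) * f z"
proof -
  define H where "H z = (\<Sum>x\<in>W. if B z x = 0 then f x else 0)" for z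
  define X K t G where "X = q ^ r" and "K = (q - 1) * m * (X + 1)" and "t = (\<Sum>x\<in>W. f x)"
    and "G = (\<Sum>x\<in>W. (f x)\<^sup>2)"
  have t: "t = (q - 1) * m * (q * X + 1)" using total_weight[OF ell ov] by (simp add: t_def X_def)
  have W: "vec.subspace W" using ell by (simp add: elliptic_on_def)
  have singular: "H z = K - X * (q - 1) * f z" if z: "z \<in> W" "z \<noteq> 0" "Q z = 0" for z
  proof -
    obtain z' where hp: "hyperbolic_pair W z z'" using ex_hyperbolic_pair_elliptic[OF ell] z by blast
    obtain k where r: "r = Suc k" using elliptic_on_0 ell z by (cases r) auto
    have "(\<Sum>u\<in>perp_pair W z z'. project_weight (perp_pair W z z') z f u) = (q - 1) * (m - f z) * (q ^ (k + 1) + 1)"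
      using ell unfolding r
      by (intro total_weight[OF elliptic_on_perp_pair[OF _ hp] project_weight_ovoid[OF hp ov]])
    then show ?thesis unfolding H_def sum_weight_perp[OF hp ov] K_def X_def r by (simp add: algebra_simps)
  qed
  have card: "int (card W) = q\<^sup>2 * X\<^sup>2"
    using elliptic_on_card[OF ell] by (simp add: X_def power_even_eq power2_eq_square)
  let ?F = "\<lambda>x b. if b = (0::'a) then f x else 0"
  have F0: "?F 0 b = 0" for b using weight_zero[OF ov] by simp
  have Fc: "?F (c *s x) (c * b) = ?F x b" if "c \<noteq> 0" for c x b using weight_scale[OF ov that] that by simp
  have HF: "(\<Sum>x\<in>W. ?F x (B x z)) = H z" for z by (simp add: H_def B_commute)
  have H1: "(\<Sum>z\<in>W. H z) = q * X\<^sup>2 * t"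
    using sum_first_moment[of r W ?F, OF ell F0 Fc]
    by (simp add: HF t_def X_def power_even_eq)
  have H2: "(\<Sum>z\<in>W. (H z)\<^sup>2) = X\<^sup>2 * (t\<^sup>2 + (q - 1)\<^sup>2 * G)"
  proof -
    have sq: "(?F x a)\<^sup>2 = (if a = 0 then (f x)\<^sup>2 else 0)" for x a by simp
    have "(\<Sum>z\<in>W. (H z)\<^sup>2) = X\<^sup>2 * (t\<^sup>2 - (q - 1) * G + q * (q - 1) * G)"
      using sum_second_moment[of r W ?F, OF ell F0 Fc]
      unfolding HF sq by (simp add: t_def G_def X_def power_even_eq)
    then show ?thesis by (simp add: algebra_simps power2_eq_square)
  qed
  \<comment> \<open>\<open>K\<close> is the value to be established for nonsingular
    \<open>z\<close>, so the second moment is centred there rather than at zero.\<close>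
  have "(\<Sum>z\<in>W. (H z - K)\<^sup>2) = (\<Sum>z\<in>W. (H z)\<^sup>2) - 2 * K * (\<Sum>z\<in>W. H z) + int (card W) * K\<^sup>2"
  proof -
    have "(\<Sum>z\<in>W. (H z - K)\<^sup>2) = (\<Sum>z\<in>W. (H z)\<^sup>2 - 2 * K * H z + K\<^sup>2)"
      by (intro sum.cong refl) (simp add: power2_diff)
    then show ?thesis by (simp only: sum.distrib sum_subtractf sum_distrib_left[symmetric] sum_constant) 
  qed
  also have "\<dots> = (X * (t - q * K))\<^sup>2 + X\<^sup>2 * (q - 1)\<^sup>2 * G"
    unfolding H1 H2 card by (simp add: algebra_simps power2_eq_square)
  also have "X * (t - q * K) = - (t - K)"
    unfolding t K_def by (simp add: algebra_simps)
  finally have total: "(\<Sum>z\<in>W. (H z - K)\<^sup>2) = (t - K)\<^sup>2 + X\<^sup>2 * (q - 1)\<^sup>2 * G"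
    by (simp add: power2_commute)
  \<comment> \<open>Nonsingular \<open>z\<close>, \<open>z = 0\<close> (where
    \<open>H 0 = t\<close>) and nonzero singular \<open>z\<close> contribute separately. The last
    two already exhaust the total, so the nonnegative sum over nonsingular \<open>z\<close>
    vanishes.\<close>
  have split: "(H z - K)\<^sup>2 = (if Q z \<noteq> 0 then (H z - K)\<^sup>2 else 0) + (if z = 0 then (t - K)\<^sup>2 else 0)
      + X\<^sup>2 * (q - 1)\<^sup>2 * (f z)\<^sup>2" if "z \<in> W" for z
  proof (cases "Q z = 0")
    case True
    show ?thesis
    proof (cases "z = 0")
      case True
      then show ?thesis using weight_zero[OF ov] by (simp add: H_def t_def)
    next
      case False
      then show ?thesis using singular[OF that False True] True by (simp add: power_mult_distrib)
    qed
  next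
    case False
    then have "f z = 0" using ov by (auto simp: weighted_ovoid_def)
    then show ?thesis using False by auto
  qed
  have "(\<Sum>z\<in>W. (H z - K)\<^sup>2) = (\<Sum>z\<in>W. if Q z \<noteq> 0 then (H z - K)\<^sup>2 else 0) + (t - K)\<^sup>2 + X\<^sup>2 * (q - 1)\<^sup>2 * G"
    using vec.subspace_0[OF W]
    by (subst sum.cong[OF refl split]) (simp_all add: sum.distrib G_def flip: sum_distrib_left)
  then have "(\<Sum>z\<in>W. if Q z \<noteq> 0 then (H z - K)\<^sup>2 else 0) = 0" using total by simp
  then have nonsing: "\<forall>z\<in>W. (if Q z \<noteq> 0 then (H z - K)\<^sup>2 else 0) = 0"
    by (subst (asm) sum_nonneg_eq_0_iff) auto
  have "H z = K - X * (q - 1) * f z"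
  proof (cases "Q z = 0")
    case True
    then show ?thesis using singular z by blast
  next
    case False
    then have "f z = 0" using ov by (auto simp: weighted_ovoid_def)
    moreover have "H z = K" using nonsing z False by force
    ultimately show ?thesis by simp
  qed
  then show ?thesis by (simp add: H_def K_def X_def)
qed

text \<open>Double counting over the hyperplanes \<open>z\<^sup>\<bottom>\<close> with \<open>z\<close> on the line \<open>\<langle>p, p'\<rangle>\<close>.\<close>

lemma hyperbolic_line_weight:
  assumes ell: "elliptic_on (Suc k) W" and ov: "weighted_ovoid W m f" and hp: "hyperbolic_pair W p p'"
  shows "(\<Sum>x\<in>perp_pair W p p'. f x) = (q - 1) * (m * (q ^ k + 1) - q ^ k * (f p + f p'))"
proof -
  note h = hp[unfolded hyperbolic_pair_def] hyperbolic_pair_B[OF hp]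
  define H where "H z = (\<Sum>x\<in>W. if B z x = 0 then f x else 0)" for z
  define X K t u where "X = q ^ k" and "K = (q - 1) * m * (q * X + 1)" and "t = (\<Sum>x\<in>W. f x)"
    and "u = (\<Sum>x\<in>perp_pair W p p'. f x)"
  have t: "t = (q - 1) * m * (q\<^sup>2 * X + 1)"
    using total_weight[OF ell ov] by (simp add: t_def X_def power2_eq_square)
  have f0: "f 0 = 0" by (rule weight_zero[OF ov])
  have H0: "H 0 = t" by (simp add: H_def t_def)
  have H: "H z = K - q * X * (q - 1) * f z" if "z \<in> W" "z \<noteq> 0" for z
    using hyperplane_weight[OF ell ov that] by (simp add: H_def K_def X_def)
  \<comment> \<open>For fixed \<open>x\<close> the condition is one linear equation in
    \<open>a\<close> and \<open>b\<close>: it has \<open>q\<^sup>2\<close> solutions if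
    \<open>x\<close> is orthogonal to both \<open>p\<close> and \<open>p'\<close>, and
    \<open>q\<close> otherwise.\<close>
  have inner: "(\<Sum>a\<in>UNIV. \<Sum>b\<in>UNIV. if B (a *s p + b *s p') x = 0 then f x else 0) =
      q * f x + (if x \<in> perp_pair W p p' then (q\<^sup>2 - q) * f x else 0)" if x: "x \<in> W" for x
  proof -
    have "(\<Sum>a\<in>UNIV. \<Sum>b\<in>UNIV. if B (a *s p + b *s p') x = 0 then f x else 0) =
        (\<Sum>b\<in>UNIV. \<Sum>a\<in>UNIV. if B (a *s p + b *s p') x = 0 then f x else 0)"
      by (rule sum.swap)
    also have "\<dots> = f x * (\<Sum>b\<in>UNIV. \<Sum>a\<in>UNIV. if a * B p x + b * B p' x = 0 then 1 else 0)"
      unfolding sum_distrib_left by (intro sum.cong refl) simp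
    also have "\<dots> = f x * (\<Sum>b\<in>UNIV. if B p x = 0 then (if b * B p' x + 0 = 0 then 1 else 0) * q else 1)"
      unfolding sum_affine_zero by (intro arg_cong[of _ _ "\<lambda>s. f x * s"] sum.cong refl) simp
    also have "\<dots> = q * f x + (if x \<in> perp_pair W p p' then (q\<^sup>2 - q) * f x else 0)"
    proof (cases "B p x = 0")
      case True
      have "(\<Sum>b\<in>UNIV. (if b * B p' x + 0 = 0 then 1 else 0) * q) = (if B p' x = 0 then q else 1) * q"
        unfolding sum_distrib_right[symmetric] sum_affine_zero by simp
      then show ?thesis using True x by (simp add: perp_pair_def power2_eq_square algebra_simps)
    next
      case False
      then show ?thesis by (simp add: perp_pair_def q_card)
    qed
    finally show ?thesis .
  qed
  have "(\<Sum>a\<in>UNIV. \<Sum>b\<in>UNIV. H (a *s p + b *s p')) =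
      (\<Sum>a\<in>UNIV. \<Sum>x\<in>W. \<Sum>b\<in>UNIV. if B (a *s p + b *s p') x = 0 then f x else 0)"
    unfolding H_def by (intro sum.cong refl sum.swap)
  also have "\<dots> = (\<Sum>x\<in>W. \<Sum>a\<in>UNIV. \<Sum>b\<in>UNIV. if B (a *s p + b *s p') x = 0 then f x else 0)"
    by (rule sum.swap)
  also have "\<dots> = (\<Sum>x\<in>W. q * f x + (if x \<in> perp_pair W p p' then (q\<^sup>2 - q) * f x else 0))"
    by (intro sum.cong refl inner)
  also have "\<dots> = q * t + (q\<^sup>2 - q) * u"
  proof -
    have "{x \<in> W. x \<in> perp_pair W p p'} = perp_pair W p p'" by (auto simp: perp_pair_def)
    then show ?thesis
      by (simp add: sum.distrib t_def u_def sum.If_cases Int_def flip: sum_distrib_left)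
  qed
  finally have 1: "(\<Sum>a\<in>UNIV. \<Sum>b\<in>UNIV. H (a *s p + b *s p')) = q * t + (q\<^sup>2 - q) * u" .
  \<comment> \<open>As \<open>Q ?z = a * b\<close>, the singular vectors of the line are the
    multiples of \<open>p\<close> and of \<open>p'\<close>. The last term corrects the case
    \<open>a = b = 0\<close>, where the whole of \<open>W\<close> is summed.\<close>
  have Hab: "H (a *s p + b *s p') = K - q * X * (q - 1) * (if b = 0 then f (a *s p) else if a = 0 then f (b *s p') else 0) +
      (if a = 0 then if b = 0 then t - K else 0 else 0)" for a b
  proof (cases "a = 0 \<and> b = 0")
    case True
    then show ?thesis by (simp add: H0 f0)
  next
    case False
    let ?z = "a *s p + b *s p'"
    have z: "?z \<in> W" using h by (simp add: vec.subspace_add vec.subspace_scale)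
    have "B p ?z = b" "B p' ?z = a" using h by simp_all
    then have z0: "?z \<noteq> 0" using False B_zero(2)[of p] B_zero(2)[of p'] by metis
    have "0 \<in> perp_pair W p p'" using h by (simp add: perp_pair_def vec.subspace_0)
    then have Qz: "Q ?z = a * b" using Q_split[OF hp, of 0 a b] by simp
    have "f ?z = 0" if "a \<noteq> 0" "b \<noteq> 0" using that Qz ov by (auto simp: weighted_ovoid_def)
    then show ?thesis using H[OF z z0] False by auto
  qed
  have fline: "(\<Sum>a\<in>UNIV. \<Sum>b\<in>UNIV. if b = 0 then f (a *s p) else if a = 0 then f (b *s p') else 0) =
      (q - 1) * (f p + f p')"
  proof -
    have "(\<Sum>a\<in>UNIV. \<Sum>b\<in>UNIV. if b = 0 then f (a *s p) else if a = 0 then f (b *s p') else 0) =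
      (\<Sum>a\<in>UNIV. \<Sum>b\<in>UNIV. (if b = 0 then f (a *s p) else 0) + (if a = 0 then f (b *s p') else 0))"
      by (intro sum.cong refl) (simp add: f0)
    also have "\<dots> = (\<Sum>a\<in>UNIV. f (a *s p)) + (\<Sum>a\<in>UNIV. if a = (0::'a) then \<Sum>b\<in>UNIV. f (b *s p') else 0)"
    proof -
      have "(\<Sum>b\<in>UNIV. if a = 0 then f (b *s p') else 0) = (if a = 0 then \<Sum>b\<in>UNIV. f (b *s p') else 0)" for a :: 'a
        by simp
      then show ?thesis by (simp add: sum.distrib)
    qed
    finally show ?thesis by (simp add: sum_weight_line[OF ov] algebra_simps)
  qed
  have corner: "(\<Sum>a\<in>UNIV. \<Sum>b\<in>UNIV. if a = (0::'a) then if b = (0::'a) then t - K else 0 else 0) = t - K"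
  proof -
    have "(\<Sum>a\<in>UNIV. \<Sum>b\<in>UNIV. if a = (0::'a) then if b = (0::'a) then t - K else 0 else 0) =
        (\<Sum>a\<in>UNIV. if a = (0::'a) then t - K else 0)"
      by (intro sum.cong refl) simp
    then show ?thesis by simp
  qed
  have "(\<Sum>a\<in>UNIV. \<Sum>b\<in>UNIV. H (a *s p + b *s p')) =
      q\<^sup>2 * K - q * X * (q - 1) * ((q - 1) * (f p + f p')) + (t - K)"
    unfolding Hab sum.distrib sum_subtractf corner sum_distrib_left[symmetric] fline
    by (simp add: q_card power2_eq_square)
  then have "q * (q - 1) * u = q\<^sup>2 * K - q * X * (q - 1) * ((q - 1) * (f p + f p')) - K - (q - 1) * t"
    using 1 by (simp add: algebra_simps power2_eq_square)
  also have "\<dots> = q * (q - 1) * ((q - 1) * (m * (X + 1) - X * (f p + f p')))"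
    unfolding K_def t by (simp add: algebra_simps power2_eq_square)
  finally show ?thesis using q_ge_2 by (simp add: u_def X_def)
qed

text \<open>The sum splits into the point \<open>p\<close>, the rest of
  \<open>p\<^sup>\<bottom>\<close>, and the points off \<open>p\<^sup>\<bottom>\<close>. The values
  of \<open>f\<close> at the last are affine in sums of \<open>f\<close> over parts of
  \<open>p\<^sup>\<bottom>\<close>, so the Parseval identity on the complement evaluates their
  squares.\<close>

lemma sum_project_squares:
  assumes ell: "elliptic_on (Suc k) W" and ov: "weighted_ovoid W m f" and hp: "hyperbolic_pair W p p'"
  defines "s \<equiv> project_weight (perp_pair W p p') p f"
  shows "(\<Sum>x\<in>W. (f x)\<^sup>2) =
     (q - 1) * ((f p)\<^sup>2 + ((q - 1) * m + f p)\<^sup>2)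
     + (q + 1) * (\<Sum>w\<in>perp_pair W p p'. project_weight (perp_pair W p p') p (\<lambda>x. (f x)\<^sup>2) w)
     - (\<Sum>w\<in>perp_pair W p p'. (s w)\<^sup>2)"
proof -
  note h = hp[unfolded hyperbolic_pair_def] hyperbolic_pair_B[OF hp]
  let ?W' = "perp_pair W p p'"
  have ell': "elliptic_on k ?W'" by (rule elliptic_on_perp_pair[OF ell hp])
  have sub': "vec.subspace ?W'" using ell' by (simp add: elliptic_on_def)
  have f0: "f 0 = 0" by (rule weight_zero[OF ov])
  txt \<open>The vectors \<open>y v\<close> represent the singular points not orthogonal to \<open>p\<close>, and \<open>u v\<close> is the sum
    of \<open>f\<close> over \<open>p\<^sup>\<bottom> \<inter> (y v)\<^sup>\<bottom>\<close>.\<close>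
  define F where "F w b = (if w = 0 then 0 else f ((- b) *s p + w))" for w b
  define y where "y v = (- Q v) *s p + 1 *s p' + v" for v
  define u where "u v = (\<Sum>w\<in>?W'. F w (B w v))" for v
  define X A S G' where "X = q ^ k" and "A = (\<Sum>w\<in>?W'. project_weight ?W' p (\<lambda>x. (f x)\<^sup>2) w)"
    and "S = (\<Sum>w\<in>?W'. s w)" and "G' = (\<Sum>w\<in>?W'. (s w)\<^sup>2)"
  define Y where "Y = (\<Sum>v\<in>?W'. (f (y v))\<^sup>2)"
  have neg: "(\<Sum>a\<in>UNIV. g (- a)) = (\<Sum>a\<in>(UNIV :: 'a set). (g a :: int))" for g
    by (rule sum.reindex_bij_betw, rule bij_betw_byWitness[where f' = uminus]) auto
  \<comment> \<open>Setting \<open>F\<close> to zero at \<open>w = 0\<close> meets the Parseval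
    hypothesis and leaves \<open>u\<close> unchanged: there only \<open>b = B 0 v = 0\<close>
    occurs, and \<open>f 0 = 0\<close>.\<close>
  have F0: "F 0 b = 0" for b by (simp add: F_def)
  have Fc: "F (c *s x) (c * b) = F x b" if "c \<noteq> 0" for c x b
  proof -
    have "(- (c * b)) *s p + c *s x = c *s ((- b) *s p + x)" by (simp add: vec.scale_right_distrib vec.scale_right_diff_distrib)
    then show ?thesis using that by (simp add: F_def weight_scale[OF ov] del: vec.scale_minus_left)
  qed
  have Fs: "(\<Sum>a\<in>UNIV. F w a) = s w" if "w \<in> ?W'" for w
    using that neg[of "\<lambda>a. f (a *s p + w)"] by (simp add: F_def s_def project_weight_def del: vec.scale_minus_left)
  have FA: "(\<Sum>a\<in>UNIV. (F w a)\<^sup>2) = project_weight ?W' p (\<lambda>x. (f x)\<^sup>2) w" if "w \<in> ?W'" for w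
    using that neg[of "\<lambda>a. (f (a *s p + w))\<^sup>2"] by (simp add: F_def project_weight_def del: vec.scale_minus_left)
  have S: "S = (q - 1) * (m - f p) * (q * X + 1)"
    using total_weight[OF ell' project_weight_ovoid[OF hp ov]] by (simp add: S_def s_def X_def)
  have M1: "(\<Sum>v\<in>?W'. u v) = q * X\<^sup>2 * S"
    using sum_first_moment[of k ?W' F, OF ell' F0 Fc]
    by (simp add: u_def Fs S_def X_def power_even_eq)
  have M2: "(\<Sum>v\<in>?W'. (u v)\<^sup>2) = X\<^sup>2 * (S\<^sup>2 - (q - 1) * G' + q * (q - 1) * A)"
    using sum_second_moment[of k ?W' F, OF ell' F0 Fc]
    by (simp add: u_def Fs FA S_def G'_def A_def X_def power_even_eq)
  \<comment> \<open>\<open>p\<close> and \<open>y v\<close> again form a hyperbolic pair, so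
    \<open>hyperbolic_line_weight\<close> can be solved for \<open>f (y v)\<close>. A vector
    \<open>a *s p + w\<close> is orthogonal to \<open>y v\<close> exactly for
    \<open>a = - B w v\<close>, which explains the argument of \<open>F\<close> in
    \<open>u v\<close>.\<close>
  have cell: "(q - 1) * X * f (y v) = (q - 1) * (m * (X + 1) - X * f p) - u v" if v: "v \<in> ?W'" for v
  proof -
    have hpy: "hyperbolic_pair W p (y v)"
      unfolding hyperbolic_pair_def
    proof (intro conjI)
      show "y v \<in> W" using h v unfolding y_def by (auto simp: perp_pair_def vec.subspace_add vec.subspace_scale vec.subspace_diff)
      show "Q (y v) = 0" using Q_split[OF hp v, of "- Q v" 1] unfolding y_def by simp
      show "B p (y v) = 1" using h v by (simp add: y_def perp_pair_def)
    qed (use h in auto)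
    have "(\<Sum>x\<in>perp_pair W p (y v). f x) = (\<Sum>x\<in>W. if B p x = 0 \<and> B (y v) x = 0 then f x else 0)"
      by (simp add: sum.If_cases Int_def perp_pair_def conj_assoc)
    also have "\<dots> = (\<Sum>a\<in>UNIV. \<Sum>b\<in>UNIV. \<Sum>w\<in>?W'. if b = (0::'a) then if a = - B w v then f (a *s p + w) else 0 else 0)"
      unfolding sum_hyperbolic_split[OF hp]
    proof (intro sum.cong refl)
      fix a b :: 'a and w assume w: "w \<in> ?W'"
      let ?x = "a *s p + b *s p' + w"
      have 1: "B p ?x = b" using h w by (simp add: perp_pair_def)
      have 2: "B (y v) ?x = - Q v * b + a + B v w"
        using h w v B_commute[of v p] B_commute[of v p'] by (simp add: y_def perp_pair_def)
      show "(if B p ?x = 0 \<and> B (y v) ?x = 0 then f ?x else 0) =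
          (if b = 0 then if a = - B w v then f (a *s p + w) else 0 else 0)"
        using 1 2 B_commute[of v w] by (auto simp: add_eq_0_iff2)
    qed
    also have "\<dots> = (\<Sum>a\<in>UNIV. \<Sum>w\<in>?W'. if a = - B w v then f (a *s p + w) else 0)"
    proof (intro sum.cong refl)
      fix a
      have "(\<Sum>b\<in>UNIV. \<Sum>w\<in>?W'. if b = (0::'a) then if a = - B w v then f (a *s p + w) else 0 else 0) =
          (\<Sum>b\<in>UNIV. if b = (0::'a) then \<Sum>w\<in>?W'. if a = - B w v then f (a *s p + w) else 0 else 0)"
        by (intro sum.cong refl) simp
      then show "(\<Sum>b\<in>UNIV. \<Sum>w\<in>?W'. if b = (0::'a) then if a = - B w v then f (a *s p + w) else 0 else 0) =
          (\<Sum>w\<in>?W'. if a = - B w v then f (a *s p + w) else 0)" by simp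
    qed
    also have "\<dots> = (\<Sum>w\<in>?W'. \<Sum>a\<in>UNIV. if a = - B w v then f (a *s p + w) else 0)" by (rule sum.swap)
    also have "\<dots> = u v"
      unfolding u_def by (intro sum.cong refl) (auto simp: F_def f0)
    finally have "u v = (q - 1) * (m * (X + 1) - X * (f p + f (y v)))"
      using hyperbolic_line_weight[OF ell ov hpy] by (simp add: X_def)
    then show ?thesis by (simp add: algebra_simps)
  qed
  define C where "C = (q - 1) * (m * (X + 1) - X * f p)"
  have card': "int (card ?W') = q\<^sup>2 * X\<^sup>2"
    using elliptic_on_card[OF ell'] by (simp add: X_def power_even_eq power2_eq_square)
  have "((q - 1) * X)\<^sup>2 * Y = (\<Sum>v\<in>?W'. ((q - 1) * X * f (y v))\<^sup>2)"
    by (simp add: Y_def sum_distrib_left power_mult_distrib)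
  also have "\<dots> = (\<Sum>v\<in>?W'. C\<^sup>2 - 2 * C * u v + (u v)\<^sup>2)"
    by (intro sum.cong refl) (simp add: cell C_def power2_diff)
  also have "\<dots> = q\<^sup>2 * X\<^sup>2 * C\<^sup>2 - 2 * C * (q * X\<^sup>2 * S) + X\<^sup>2 * (S\<^sup>2 - (q - 1) * G' + q * (q - 1) * A)"
    by (simp only: sum.distrib sum_subtractf sum_distrib_left[symmetric] sum_constant M1 M2 card')
  also have "\<dots> = X\<^sup>2 * ((q * C - S)\<^sup>2 - (q - 1) * G' + q * (q - 1) * A)"
    by (simp add: power2_eq_square algebra_simps)
  also have "q * C - S = (q - 1) * ((q - 1) * m + f p)"
    unfolding C_def S by (simp add: algebra_simps)
  finally have "((q - 1) * X\<^sup>2) * ((q - 1) * Y) =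
      ((q - 1) * X\<^sup>2) * ((q - 1) * ((q - 1) * m + f p)\<^sup>2 - G' + q * A)"
    by (simp add: power2_eq_square algebra_simps)
  moreover have "(q - 1) * X\<^sup>2 \<noteq> 0" using q_ge_2 by (simp add: X_def)
  ultimately have Y: "(q - 1) * Y = (q - 1) * ((q - 1) * m + f p)\<^sup>2 - G' + q * A"
    by (simp only: mult_cancel_left) simp
  have inner: "(\<Sum>a\<in>UNIV. \<Sum>w\<in>?W'. (f (a *s p + b *s p' + w))\<^sup>2) =
      (if b = 0 then (q - 1) * (f p)\<^sup>2 + A else Y)" for b
  proof (cases "b = 0")
    case True
    have "(\<Sum>a\<in>UNIV. \<Sum>w\<in>?W'. (f (a *s p + w))\<^sup>2) = (\<Sum>w\<in>?W'. \<Sum>a\<in>UNIV. (f (a *s p + w))\<^sup>2)"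
      by (rule sum.swap)
    also have "\<dots> = (\<Sum>w\<in>?W'. (if w = 0 then \<Sum>a\<in>UNIV. (f (a *s p))\<^sup>2 else 0) + project_weight ?W' p (\<lambda>x. (f x)\<^sup>2) w)"
      by (intro sum.cong refl) (auto simp: project_weight_def)
    also have "\<dots> = (\<Sum>a\<in>UNIV. (f (a *s p))\<^sup>2) + A"
      using vec.subspace_0[OF sub'] by (simp add: sum.distrib A_def)
    also have "(\<Sum>a\<in>UNIV. (f (a *s p))\<^sup>2) = (\<Sum>a\<in>UNIV. if a = (0::'a) then 0 else (f p)\<^sup>2)"
      by (intro sum.cong refl) (auto simp: f0 weight_scale[OF ov])
    finally show ?thesis using True by (simp add: sum_If_zero)
  next
    \<comment> \<open>Singularity forces \<open>a = - b * Q v\<close>, and the vector is then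
      \<open>b *s y v\<close>. By scalar invariance every nonzero \<open>b\<close> thus contributes
      the same sum \<open>Y\<close>.\<close>
    case b: False
    have single: "(\<Sum>a\<in>UNIV. (f (a *s p + b *s p' + b *s v))\<^sup>2) = (f (y v))\<^sup>2" if v: "v \<in> ?W'" for v
    proof -
      have bv: "b *s v \<in> ?W'" using sub' v by (rule vec.subspace_scale)
      have "f (a *s p + b *s p' + b *s v) = 0" if "a \<noteq> - b * Q v" for a
      proof -
        have "Q (a *s p + b *s p' + b *s v) = b * (a + b * Q v)"
          using Q_split[OF hp bv, of a b] by (simp add: power2_eq_square algebra_simps)
        then have "Q (a *s p + b *s p' + b *s v) \<noteq> 0" using b that by (simp add: add_eq_0_iff2)
        then show ?thesis using ov by (auto simp: weighted_ovoid_def)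
      qed
      then have "(\<Sum>a\<in>UNIV. (f (a *s p + b *s p' + b *s v))\<^sup>2) =
          (\<Sum>a\<in>UNIV. if a = - b * Q v then (f ((- b * Q v) *s p + b *s p' + b *s v))\<^sup>2 else 0)"
        by (intro sum.cong refl) auto
      also have "\<dots> = (f (b *s y v))\<^sup>2"
        by (simp add: y_def vec.scale_right_distrib vec.scale_right_diff_distrib)
      finally show ?thesis using b by (simp add: weight_scale[OF ov])
    qed
    have "bij_betw (\<lambda>v. b *s v) ?W' ?W'"
      using b sub' by (intro bij_betw_byWitness[where f' = "\<lambda>v. inverse b *s v"]) (auto simp: vec.subspace_scale)
    then have re: "(\<Sum>v\<in>?W'. g (b *s v)) = (\<Sum>w\<in>?W'. (g w :: int))" for g by (rule sum.reindex_bij_betw)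
    have "(\<Sum>a\<in>UNIV. \<Sum>w\<in>?W'. (f (a *s p + b *s p' + w))\<^sup>2) = (\<Sum>w\<in>?W'. \<Sum>a\<in>UNIV. (f (a *s p + b *s p' + w))\<^sup>2)"
      by (rule sum.swap)
    also have "\<dots> = (\<Sum>v\<in>?W'. \<Sum>a\<in>UNIV. (f (a *s p + b *s p' + b *s v))\<^sup>2)"
      by (rule re[symmetric])
    finally show ?thesis using b single by (simp add: Y_def)
  qed
  have "(\<Sum>x\<in>W. (f x)\<^sup>2) = (\<Sum>b\<in>UNIV. \<Sum>a\<in>UNIV. \<Sum>w\<in>?W'. (f (a *s p + b *s p' + w))\<^sup>2)"
    unfolding sum_hyperbolic_split[OF hp] by (rule sum.swap)
  also have "\<dots> = (q - 1) * (f p)\<^sup>2 + A + (q - 1) * Y"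
    unfolding inner sum_If_zero ..
  finally show ?thesis unfolding Y G'_def[symmetric] A_def[symmetric] by (simp add: algebra_simps)
qed

section \<open>The congruence\<close>

text \<open>The projected weight vanishes at 0 and is scalar invariant, so its sum over vectors is
  \<open>q - 1\<close> times a sum over points.\<close>

lemma sum_project_weight_dvd:
  assumes W': "vec.subspace W'" and scale: "\<And>c x. c \<noteq> 0 \<Longrightarrow> g (c *s x) = g x"
  shows "q - 1 dvd (\<Sum>w\<in>W'. project_weight W' p g w)"
proof -
  have "(\<Sum>w\<in>W'. project_weight W' p g w) = (\<Sum>w\<in>W' - {0}. project_weight W' p g w)"
    by (rule sum.mono_neutral_right) (auto simp: project_weight_def)
  also have "q - 1 dvd \<dots>"
    unfolding q_def
    by (subst sum_scalar_invariant)
      (use W' in \<open>auto simp: project_weight_scale[OF W' scale] vec.subspace_scale\<close>)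
  finally show ?thesis .
qed

text \<open>For odd \<open>q\<close> the extra factor 2 is what determines \<open>F m\<close> itself rather than \<open>2 F m\<close>; it comes
  from \<open>f\<^sup>2 \<equiv> f\<close> modulo 2.\<close>

lemma sum_squares_dvd:
  fixes e :: int
  assumes "elliptic_on r W" "weighted_ovoid W m f" and e: "e = (if even q then 1 else 2)"
  shows "(q - 1) * ((q + 1) * e) dvd (\<Sum>x\<in>W. (f x)\<^sup>2) - (q - 1) * (2 * m\<^sup>2)"
  using assms(1,2)
proof (induction r arbitrary: W m f)
  case 0
  have "f x = 0" if "x \<in> W" for x
    using 0(2) elliptic_on_0[OF 0(1) that] by (auto simp: weighted_ovoid_def)
  then have f0: "(\<Sum>x\<in>W. f x) = 0" "(\<Sum>x\<in>W. (f x)\<^sup>2) = 0" by simp_all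
  have "(q - 1) * (q + 1) * m = 0" using total_weight[OF 0] f0 by (simp add: algebra_simps)
  then have "m = 0" using q_ge_2 by simp
  then show ?case using f0 by simp
next
  case (Suc k)
  obtain p p' where hp: "hyperbolic_pair W p p'"
    using elliptic_on_Suc_singular[OF Suc.prems(1)] ex_hyperbolic_pair_elliptic[OF Suc.prems(1)] by blast
  let ?W' = "perp_pair W p p'"
  let ?s = "project_weight ?W' p f"
  have ell': "elliptic_on k ?W'" by (rule elliptic_on_perp_pair[OF Suc.prems(1) hp])
  have W': "vec.subspace ?W'" using ell' by (simp add: elliptic_on_def)
  have ov': "weighted_ovoid ?W' (m - f p) ?s" by (rule project_weight_ovoid[OF hp Suc.prems(2)])
  note scale = weight_scale[OF Suc.prems(2)]
  define A G' where "A = (\<Sum>w\<in>?W'. project_weight ?W' p (\<lambda>x. (f x)\<^sup>2) w)"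
    and "G' = (\<Sum>w\<in>?W'. (?s w)\<^sup>2)"
  have A: "(q - 1) * e dvd A"
  proof (cases "even q")
    case True
    then show ?thesis using sum_project_weight_dvd[OF W', of "\<lambda>x. (f x)\<^sup>2" p] by (simp add: A_def e scale)
  next
    case False
    \<comment> \<open>\<open>?g\<close> is an integer-valued invariant weight, so its part gains a
      factor 2 besides \<open>q - 1\<close>. The remaining part is a total weight with the factor
      \<open>q ^ (k + 1) + 1\<close>, which is even for odd \<open>q\<close>.\<close>
    let ?g = "\<lambda>x. f x * (f x - 1) div 2"
    have sq: "(f x)\<^sup>2 = 2 * ?g x + f x" for x by (simp add: power2_eq_square algebra_simps)
    have "project_weight ?W' p (\<lambda>x. (f x)\<^sup>2) w = 2 * project_weight ?W' p ?g w + ?s w" for w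
      unfolding sq by (simp add: project_weight_def sum.distrib sum_distrib_left)
    then have "A = 2 * (\<Sum>w\<in>?W'. project_weight ?W' p ?g w) + (\<Sum>w\<in>?W'. ?s w)"
      by (simp add: A_def sum.distrib sum_distrib_left)
    also have "\<dots> = 2 * (\<Sum>w\<in>?W'. project_weight ?W' p ?g w) + (q - 1) * ((q ^ (k + 1) + 1) * (m - f p))"
      unfolding total_weight[OF ell' ov'] by (simp add: mult_ac)
    finally have "A = 2 * (\<Sum>w\<in>?W'. project_weight ?W' p ?g w) + (q - 1) * ((q ^ (k + 1) + 1) * (m - f p))" .
    moreover have "(q - 1) * 2 dvd 2 * (\<Sum>w\<in>?W'. project_weight ?W' p ?g w)"
    proof -
      have "q - 1 dvd (\<Sum>w\<in>?W'. project_weight ?W' p ?g w)"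
        by (rule sum_project_weight_dvd[OF W']) (simp add: scale)
      from mult_dvd_mono[OF dvd_refl[of 2] this] show ?thesis by (simp only: mult.commute)
    qed
    moreover have "(q - 1) * 2 dvd (q - 1) * ((q ^ (k + 1) + 1) * (m - f p))"
      using False by (intro mult_dvd_mono dvd_mult2) auto
    ultimately show ?thesis using False by (simp only: e if_False dvd_add)
  qed
  have "(q - 1) * ((q + 1) * e) dvd (q + 1) * A"
    using mult_dvd_mono[OF dvd_refl[of "q + 1"] A] by (simp add: mult_ac)
  moreover have "(q - 1) * ((q + 1) * e) dvd G' - (q - 1) * (2 * (m - f p)\<^sup>2)"
    unfolding G'_def by (rule Suc.IH[OF ell' ov'])
  \<comment> \<open>This is what remains of the recursion after the terms in \<open>A\<close> and
    \<open>G'\<close> are split off, written so that the last factor is visibly even for odd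
    \<open>q\<close>.\<close>
  moreover have "(q - 1) * ((q + 1) * e) dvd (q - 1) * ((q + 1) * ((q + 1) * m\<^sup>2 + 2 * (m * (f p - 2 * m))))"
    using e by (intro mult_dvd_mono dvd_refl) auto
  moreover have "(\<Sum>x\<in>W. (f x)\<^sup>2) - (q - 1) * (2 * m\<^sup>2) =
      (q - 1) * ((q + 1) * ((q + 1) * m\<^sup>2 + 2 * (m * (f p - 2 * m)))) + (q + 1) * A
      - (G' - (q - 1) * (2 * (m - f p)\<^sup>2))"
    unfolding sum_project_squares[OF Suc.prems hp] A_def[symmetric] G'_def[symmetric]
    by (simp add: power2_eq_square algebra_simps)
  ultimately show ?case by (simp only: dvd_add dvd_diff)
qed

section \<open>From elliptic forms and m-ovoids to elliptic subspaces and weights\<close>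

lemma card_subspace:
  fixes U :: "('a ^ 'n) set"
  assumes "vec.subspace U"
  shows "card U = CARD('a) ^ vec.dim U"
proof -
  have span: "card (vec.span S) = CARD('a) ^ card S" if "vec.independent S" for S :: "('a ^ 'n) set"
    using finite_vec[of S] that
  proof (induction S rule: finite_induct)
    case empty
    then show ?case by simp
  next
    case (insert b S)
    have b: "b \<notin> vec.span S" and S: "vec.independent S" using insert by (auto simp: vec.independent_insert)
    have "vec.span (insert b S) = extend_by b (vec.span S)"
    proof (intro equalityI subsetI)
      fix x assume "x \<in> vec.span (insert b S)"
      then obtain c where "x - c *s b \<in> vec.span S" by (auto simp: vec.span_insert)
      from mem_extend_by[OF this, of c b] show "x \<in> extend_by b (vec.span S)" by simp
    next
      fix x assume "x \<in> extend_by b (vec.span S)"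
      then obtain c u where "x = c *s b + u" "u \<in> vec.span S" by (auto simp: extend_by_def)
      then show "x \<in> vec.span (insert b S)" by (auto simp: vec.span_insert intro!: exI[of _ c])
    qed
    then show ?case using insert S b card_extend_by[OF vec.subspace_span b] by simp
  qed
  obtain S where S: "S \<subseteq> U" "vec.independent S" "U \<subseteq> vec.span S" "card S = vec.dim U"
    using vec.basis_exists by blast
  then have "vec.span S = U" using vec.span_subspace assms by blast
  then show ?thesis using span[OF S(2)] S(4) by simp
qed

text \<open>The set of dimensions is finite and contains that of \<open>{0}\<close>, so its
  \<open>Max\<close> is attained and bounds all others; \<open>card_subspace\<close> turns
  dimensions into cardinalities.\<close>

lemma elliptic_form_elliptic_on:
  assumes "elliptic_form r Q"
  shows "elliptic_on r UNIV"
proof -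
  let ?D = "{vec.dim U | U. totally_singular Q U}"
  have fin: "finite ?D" by (rule finite_subset[of _ "vec.dim ` UNIV"]) auto
  have "totally_singular Q {0}" by (simp add: totally_singular_def vec.subspace_single_0)
  then have ne: "?D \<noteq> {}" by blast
  have max: "Max ?D = r" using assms by (simp add: elliptic_form_def witt_index_def)
  have "r \<in> ?D" using Max_in[OF fin ne] max by simp
  then obtain U where "totally_singular Q U" "vec.dim U = r" by blast
  then have U: "\<exists>U. totally_singular Q U \<and> card U = CARD('a) ^ r"
    using card_subspace by (auto simp: totally_singular_def)
  have "card U \<le> CARD('a) ^ r" if "totally_singular Q U" for U
  proof -
    have "vec.dim U \<le> r" using Max_ge[OF fin, of "vec.dim U"] max that by auto
    then have "CARD('a) ^ vec.dim U \<le> CARD('a) ^ r" by (intro power_increasing) (auto simp: Suc_le_eq)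
    then show ?thesis using card_subspace that by (simp add: totally_singular_def)
  qed
  moreover have "card (UNIV :: ('a ^ 'n) set) = CARD('a) ^ (2 * r + 2)"
    using assms by (simp add: elliptic_form_def)
  moreover have "no_singular_radical UNIV"
    using assms by (auto simp: elliptic_form_def nondegenerate_def no_singular_radical_def)
  ultimately show ?thesis using U by (simp add: elliptic_on_def)
qed

text \<open>An indicator function, hence equal to its own square.\<close>

definition ovoid_weight :: "('a ^ 'n) set set \<Rightarrow> 'a ^ 'n \<Rightarrow> int" where
  "ovoid_weight \<O> x = (if x \<noteq> 0 \<and> vec.span {x} \<in> \<O> then 1 else 0)"

lemma point_eq_span:
  fixes P :: "('a ^ 'n) set"
  assumes "vec.subspace P" "vec.dim P = 1"
  shows "\<exists>x. x \<noteq> 0 \<and> P = vec.span {x}"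
proof -
  obtain S where S: "S \<subseteq> P" "vec.independent S" "P \<subseteq> vec.span S" "card S = vec.dim P"
    using vec.basis_exists by blast
  then obtain x where x: "S = {x}" using assms by (auto simp: card_1_singleton_iff)
  have "x \<noteq> 0" using S x vec.dependent_zero by blast
  moreover have "P = vec.span {x}" using S x assms vec.span_subspace by blast
  ultimately show ?thesis by blast
qed

lemma weighted_ovoid_of_m_ovoid:
  assumes "m_ovoid Q m \<O>"
  shows "weighted_ovoid UNIV (int m) (ovoid_weight \<O>)"
  unfolding weighted_ovoid_def
proof (intro conjI allI impI)
  have pts: "P \<in> \<O> \<Longrightarrow> vec.subspace P \<and> vec.dim P = 1 \<and> (\<forall>x\<in>P. Q x = 0)" for P
    using assms by (auto simp: m_ovoid_def quadric_points_def)
  show "ovoid_weight \<O> (c *s x) = ovoid_weight \<O> x" if "c \<noteq> 0" for c x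
    using that by (simp add: ovoid_weight_def span_scale_eq)
  show "x \<in> UNIV" for x :: "'a ^ 'n" by simp
  show "x \<noteq> 0" if "ovoid_weight \<O> x \<noteq> 0" for x using that by (auto simp: ovoid_weight_def)
  show "Q x = 0" if "ovoid_weight \<O> x \<noteq> 0" for x
    using that pts[of "vec.span {x}"] vec.span_base[of x "{x}"] by (auto simp: ovoid_weight_def split: if_splits)
  fix U assume "generator_on UNIV U"
  then have gen: "generator Q U" by (simp add: generator_on_def generator_def)
  then have U: "vec.subspace U" by (simp add: generator_def totally_singular_def)
  let ?S = "{x \<in> U. x \<noteq> 0 \<and> vec.span {x} \<in> \<O>}"
  have img: "(\<lambda>x. vec.span {x}) ` ?S = {P \<in> \<O>. P \<subseteq> U}"
  proof (intro equalityI subsetI)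
    fix P assume "P \<in> (\<lambda>x. vec.span {x}) ` ?S"
    then show "P \<in> {P \<in> \<O>. P \<subseteq> U}" using vec.span_minimal[OF _ U] by auto
  next
    fix P assume P: "P \<in> {P \<in> \<O>. P \<subseteq> U}"
    then obtain x where "x \<noteq> 0" "P = vec.span {x}" using point_eq_span pts by blast
    then show "P \<in> (\<lambda>x. vec.span {x}) ` ?S" using P vec.span_base[of x "{x}"] by auto
  qed
  have "(\<Sum>x\<in>U. ovoid_weight \<O> x) = (\<Sum>x\<in>?S. 1)"
    by (simp add: ovoid_weight_def sum.If_cases Int_def)
  also have "\<dots> = (int CARD('a) - 1) * (\<Sum>P\<in>(\<lambda>x. vec.span {x}) ` ?S. 1)"
    by (rule sum_scalar_invariant[of "\<lambda>_. 1"]) (use U in \<open>auto simp: vec.subspace_scale span_scale_eq\<close>)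
  also have "\<dots> = (q - 1) * int (card {P \<in> \<O>. P \<subseteq> U})" unfolding img by (simp add: q_card)
  also have "card {P \<in> \<O>. P \<subseteq> U} = m" using assms gen by (simp add: m_ovoid_def)
  finally show "(\<Sum>x\<in>U. ovoid_weight \<O> x) = (q - 1) * int m" .
qed

text \<open>For a weight with values 0 and 1 the sum of squares is the total weight, which is known;
  the common factor \<open>q - 1\<close> cancels.\<close>

lemma m_ovoid_dvd:
  assumes "elliptic_form r Q" "m_ovoid Q m \<O>"
  shows "(q + 1) * (if even q then 1 else 2) dvd int m * (q ^ (r + 1) + 1) - 2 * (int m)\<^sup>2"
proof -
  let ?f = "ovoid_weight \<O>"
  note ell = elliptic_form_elliptic_on[OF assms(1)] and ov = weighted_ovoid_of_m_ovoid[OF assms(2)]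
  have "(\<Sum>x\<in>UNIV. (?f x)\<^sup>2) = (\<Sum>x\<in>UNIV. ?f x)" by (intro sum.cong) (auto simp: ovoid_weight_def)
  then have "(q - 1) * ((q + 1) * (if even q then 1 else 2)) dvd (q - 1) * (int m * (q ^ (r + 1) + 1) - 2 * (int m)\<^sup>2)"
    using sum_squares_dvd[OF ell ov refl] total_weight[OF ell ov] by (simp only: right_diff_distrib mult.assoc)
  then show ?thesis using q_ge_2 by (simp only: dvd_mult_cancel_left) auto
qed

end

section \<open>Divisibility by q + 1\<close>

lemma square_minus_one_dvd:
  fixes a :: int
  shows "a\<^sup>2 - 1 dvd a ^ (2 * j) - 1"
proof (induction j)
  case (Suc j)
  have "a ^ (2 * Suc j) - 1 = a\<^sup>2 * (a ^ (2 * j) - 1) + (a\<^sup>2 - 1)"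
    by (simp add: algebra_simps power2_eq_square)
  then show ?case using Suc by (simp only: dvd_add dvd_mult dvd_refl)
qed simp

text \<open>Modulo \<open>d\<close> the power of \<open>q\<close> reduces to 1 for odd
  \<open>r\<close> and to \<open>q\<close> for even \<open>r\<close>. The factor 2 that remains is
  removed as a unit modulo \<open>q + 1\<close> when \<open>q\<close> is even, and by cancelling it
  from the modulus \<open>2 * (q + 1)\<close> when \<open>q\<close> is odd.\<close>

lemma ovoid_F_dvd:
  fixes q r m :: nat
  assumes dvd: "(int q + 1) * (if even q then 1 else 2) dvd int m * (int q ^ (r + 1) + 1) - 2 * (int m)\<^sup>2"
  shows "int q + 1 dvd ovoid_F r q m"
proof -
  let ?q = "int q" and ?m = "int m"
  define d :: int where "d = (?q + 1) * (if even q then 1 else 2)"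
  \<comment> \<open>For odd \<open>q\<close> the factor 2 of \<open>d\<close> divides
    \<open>q - 1\<close>.\<close>
  have "d dvd (?q + 1) * (?q - 1)" unfolding d_def by (intro mult_dvd_mono) auto
  then have "d dvd ?q\<^sup>2 - 1" by (simp add: power2_eq_square algebra_simps)
  then have pow: "d dvd ?q ^ (2 * j) - 1" for j using square_minus_one_dvd dvd_trans by blast
  have hyp: "d dvd ?m * (?q ^ (r + 1) + 1) - 2 * ?m\<^sup>2" using dvd by (simp add: d_def)
  have cop: "coprime (?q + 1) 2" if "even q" using that by simp
  show ?thesis
  proof (cases "odd r")
    case True
    then obtain j where "r + 1 = 2 * j" by (metis dvdE odd_even_add odd_one)
    then have "d dvd ?m * (?q ^ (r + 1) - 1)" using pow by simp
    from dvd_diff[OF this hyp] have "d dvd 2 * (?m\<^sup>2 - ?m)" by (simp add: algebra_simps)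
    then have "?q + 1 dvd ?m\<^sup>2 - ?m"
    proof (cases "even q")
      case True
      then show ?thesis using \<open>d dvd 2 * (?m\<^sup>2 - ?m)\<close> cop
        by (simp only: d_def if_True mult_1_right coprime_dvd_mult_right_iff)
    next
      case False
      then have "2 * (?q + 1) dvd 2 * (?m\<^sup>2 - ?m)"
        using \<open>d dvd 2 * (?m\<^sup>2 - ?m)\<close> by (simp only: d_def if_False mult.commute)
      then show ?thesis by (simp only: dvd_mult_cancel_left) simp
    qed
    then show ?thesis using True by (simp add: ovoid_F_def)
  next
    case False
    then obtain j where "r = 2 * j" by blast
    then have "d dvd ?m * ?q * (?q ^ r - 1)" using pow by simp
    from dvd_diff[OF hyp this] have 1: "d dvd ?m * (?q + 1) - 2 * ?m\<^sup>2" by (simp add: algebra_simps)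
    show ?thesis
    proof (cases "even q")
      case True
      have "?q + 1 dvd ?m * (?q + 1) - 2 * ?m\<^sup>2" using 1 True by (simp add: d_def)
      from dvd_diff[OF dvd_triv_right[of "?q + 1" ?m] this] have "?q + 1 dvd 2 * ?m\<^sup>2" by simp
      then show ?thesis using cop True False by (simp add: ovoid_F_def coprime_dvd_mult_right_iff)
    next
      case odd: False
      then obtain h where h: "?q + 1 = 2 * h" by (metis dvdE even_of_nat even_plus_one_iff)
      have "2 * (?q + 1) dvd ?m * (?q + 1) - 2 * ?m\<^sup>2"
        using 1 odd by (simp only: d_def if_False mult.commute)
      \<comment> \<open>Subtracting from a multiple of the modulus reverses the sign of
        \<open>2 * m\<^sup>2\<close> but leaves \<open>m * (q + 1)\<close> with a plus sign; halving
        it produces the term with \<open>(q + 1) / 2\<close>.\<close>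
      from dvd_diff[OF dvd_triv_left[of "2 * (?q + 1)" ?m] this]
      have "2 * (?q + 1) dvd 2 * (?q + 1) * ?m - (?m * (?q + 1) - 2 * ?m\<^sup>2)" .
      also have "\<dots> = 2 * (?m\<^sup>2 + h * ?m)" unfolding h by (simp add: algebra_simps)
      finally have "?q + 1 dvd ?m\<^sup>2 + h * ?m" by (simp only: dvd_mult_cancel_left) simp
      moreover have "(?q + 1) div 2 = h" using h by simp
      ultimately show ?thesis using False odd by (simp add: ovoid_F_def)
    qed
  qed
qed

theorem theorem1p1:
  fixes Q :: "'a::{field,finite} ^ 'n::finite \<Rightarrow> 'a"
    and q r m :: nat
  assumes "CARD('a) = q"
    and "r \<ge> 1"
    and "elliptic_form r Q"
    and "\<exists>\<O>. m_ovoid Q m \<O>"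
  shows "[ovoid_F r q m = 0] (mod (int q + 1))"
proof -
  obtain \<O> where \<O>: "m_ovoid Q m \<O>" using assms by blast
  interpret quadratic_space Q "int q"
    using assms by unfold_locales (auto simp: elliptic_form_def)
  have "int q + 1 dvd ovoid_F r q m"
    using m_ovoid_dvd[OF assms(3) \<O>] by (intro ovoid_F_dvd) simp
  then show ?thesis by (simp add: cong_0_iff)
qed

end
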